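(* In the setting of the context, assume $\sigma_{\mathrm{eff,c}}^2=\boldsymbol{w}_{\mathrm c}^\top BB^\top\boldsymbol{w}_{\mathrm c}>0$ and $\rho_{\mathrm c}=(\boldsymbol{1}^\top\boldsymbol{v}_{\mathrm c})^2/N<1$. Let $\boldsymbol{x}=\boldsymbol{x}^*(\alpha)+\boldsymbol{z}$ with $\boldsymbol{z}\sim\mathcal{N}(\boldsymbol{0},C(\alpha))$ and $\gamma=\boldsymbol{w}^\top\boldsymbol{x}$. Let $\boldsymbol{b}\in\mathbb{R}^N$ be fixed (independent of $\alpha$) and let $\boldsymbol{y}=\boldsymbol{x}-\boldsymbol{b}$. Then the statistics $g_1,g_2,I_{\mathrm M}$ computed from $\boldsymbol{y}$ have the same leading limits as those computed from $\boldsymbol{x}$; namely, as $\alpha\to\alpha_{\mathrm c}^-$, $$g_1(\boldsymbol{y})=\operatorname{sgn}(\gamma)\,\frac{\mu_3(\boldsymbol{v}_{\mathrm c})}{\mu_2(\boldsymbol{v}_{\mathrm c})^{3/2}}+o_{\mathbb P}(1),$$ $$g_2(\boldsymbol{y})\to\frac{\mu_4(\boldsymbol{v}_{\mathrm c})}{\mu_2(\boldsymbol{v}_{\mathrm c})^2}\quad\text{and}\quad I_{\mathrm M}(\boldsymbol{y})\to\frac{N}{W}\,\frac{\boldsymbol{v}_{\mathrm c}^\top PAP\boldsymbol{v}_{\mathrm c}}{\boldsymbol{v}_{\mathrm c}^\top P\boldsymbol{v}_{\mathrm c}}\quad\text{in probability}.$$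
   Context: Setting. $N\ge2$. Consider the It\^o SDE $\mathrm d\boldsymbol{x}=F(\boldsymbol{x};\alpha)\,\mathrm dt+B\,\mathrm d\boldsymbol{W}$ in $\mathbb{R}^N$, with $B\in\mathbb{R}^{N\times m}$ constant, $\boldsymbol{W}$ an $m$-dimensional standard Wiener process, and $F$ sufficiently smooth in $(\boldsymbol{x},\alpha)$ ($C^2$ in a neighborhood of the equilibrium branch, including its endpoint at $\alpha_{\mathrm c}$, suffices). $\boldsymbol{x}^*(\alpha)$ is a branch of equilibria, $F(\boldsymbol{x}^*(\alpha);\alpha)=\boldsymbol{0}$, asymptotically stable for $\alpha<\alpha_{\mathrm c}$, and $M(\alpha)=-\frac{\partial F}{\partial\boldsymbol{x}}\big|_{\boldsymbol{x}=\boldsymbol{x}^*(\alpha)}$. $C=C(\alpha)$ is the stationary covariance of the linearized process $\mathrm d\boldsymbol{z}=-M\boldsymbol{z}\,\mathrm dt+B\,\mathrm d\boldsymbol{W}$, i.e. the solution of $MC+CM^\top=BB^\top$. Regular simple real critical eigenvalue assumption (in force). As $\alpha\to\alpha_{\mathrm c}^-$, $\boldsymbol{x}^*(\alpha)$ has a finite limit. For $\alpha<\alpha_{\mathrm c}$ close to $\alpha_{\mathrm c}$, $M(\alpha)$ is diagonalizable over $\mathbb{C}$ with all eigenvalues of positive real part; the eigenvalue $\lambda_1(\alpha)$ of smallest real part is real and simple, $\lambda_1(\alpha)>0$, $\lambda_1(\alpha)\to0$, and $\operatorname{Re}\lambda_k(\alpha)\ge\delta>0$ for $k=2,\dots,N$,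 with $\delta$ independent of $\alpha$. Real right and left eigenvectors $\boldsymbol{v}(\alpha),\boldsymbol{w}(\alpha)$ are chosen with $M\boldsymbol{v}=\lambda_1\boldsymbol{v}$, $\boldsymbol{w}^\top M=\lambda_1\boldsymbol{w}^\top$, $\|\boldsymbol{v}\|_2=1$, $\boldsymbol{w}^\top\boldsymbol{v}=1$, and they have finite limits $\boldsymbol{v}_{\mathrm c},\boldsymbol{w}_{\mathrm c}$ as $\alpha\to\alpha_{\mathrm c}^-$. Statistics. For $\boldsymbol{u}\in\mathbb{R}^N$: $\bar u=N^{-1}\sum_iu_i$, $\mu_k(\boldsymbol{u})=\frac1N\sum_i(u_i-\bar u)^k$, $g_1(\boldsymbol{u})=\mu_3(\boldsymbol{u})/\mu_2(\boldsymbol{u})^{3/2}$, $g_2(\boldsymbol{u})=\mu_4(\boldsymbol{u})/\mu_2(\boldsymbol{u})^2$, $I_{\mathrm M}(\boldsymbol{u})=\frac{N}{W}\frac{\sum_{i,j}A_{ij}(u_i-\bar u)(u_j-\bar u)}{\sum_i(u_i-\bar u)^2}$, where $A=(A_{ij})\in\mathbb{R}^{N\times N}$ is the fixed adjacency matrix with $W=\sum_{i,j}A_{ij}>0$. $P=I-\frac1N\boldsymbol{1}\boldsymbol{1}^\top$. $o_{\mathbb P}(1)$ denotes a term converging to $0$ in probability. *)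

theory Defs
  imports
    "HOL-Probability.Probability"
    "HOL-Computational_Algebra.Polynomial"
begin

section \<open>Smoothness and stability\<close>

definition C2_on :: "('a::real_normed_vector \<Rightarrow> 'b::real_normed_vector) \<Rightarrow> 'a set \<Rightarrow> bool" where
  "C2_on f U \<longleftrightarrow> open U \<and>
    (\<exists>(D :: 'a \<Rightarrow> ('a \<Rightarrow>\<^sub>L 'b)) (D2 :: 'a \<Rightarrow> ('a \<Rightarrow>\<^sub>L ('a \<Rightarrow>\<^sub>L 'b))).
       (\<forall>p\<in>U. (f has_derivative blinfun_apply (D p)) (at p)) \<and>
       (\<forall>p\<in>U. (D has_derivative blinfun_apply (D2 p)) (at p)) \<and>
       continuous_on U D2)"

definition ode_solution_on ::
    "('a::real_normed_vector \<Rightarrow> 'a) \<Rightarrow> real set \<Rightarrow> (real \<Rightarrow> 'a) \<Rightarrow> bool" where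
  "ode_solution_on f T \<phi> \<longleftrightarrow>
    (\<forall>t\<in>T. (\<phi> has_vector_derivative f (\<phi> t)) (at t within T))"

text \<open>
  Lyapunov stability quantifies over solutions on every interval \<open>[0,T)\<close>, so that solutions
  which might not extend to all of \<open>[0,\<infinity>)\<close> are controlled as well.
\<close>

definition asymptotically_stable :: "('a::real_normed_vector \<Rightarrow> 'a) \<Rightarrow> 'a \<Rightarrow> bool" where
  "asymptotically_stable f p \<longleftrightarrow>
    (\<forall>\<epsilon>>0. \<exists>\<eta>>0. \<forall>T>0. \<forall>\<phi>. ode_solution_on f {0..<T} \<phi> \<and> dist (\<phi> 0) p < \<eta>
        \<longrightarrow> (\<forall>t\<in>{0..<T}. dist (\<phi> t) p < \<epsilon>)) \<and>
    (\<exists>\<eta>>0. \<forall>\<phi>. ode_solution_on f {0..} \<phi> \<and> dist (\<phi> 0) p < \<eta>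
        \<longrightarrow> (\<phi> \<longlongrightarrow> p) at_top)"

section \<open>Spectral notions over the complex numbers\<close>

definition complex_matrix :: "real^'n^'m \<Rightarrow> complex^'n^'m" where
  "complex_matrix A = map_matrix complex_of_real A"

definition eigenvalue :: "complex^'n^'n \<Rightarrow> complex \<Rightarrow> bool" where
  "eigenvalue A \<mu> \<longleftrightarrow> (\<exists>u. u \<noteq> 0 \<and> A *v u = \<mu> *s u)"

definition char_polynomial :: "complex^'n^'n \<Rightarrow> complex poly" where
  "char_polynomial A = det (mat [:0, 1:] - map_matrix (\<lambda>a. [:a:]) A)"

definition simple_eigenvalue :: "complex^'n^'n \<Rightarrow> complex \<Rightarrow> bool" where
  "simple_eigenvalue A \<mu> \<longleftrightarrow> eigenvalue A \<mu> \<and> order \<mu> (char_polynomial A) = 1"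

definition diagonalizable :: "complex^'n^'n \<Rightarrow> bool" where
  "diagonalizable A \<longleftrightarrow> (\<exists>(S :: complex^'n^'n) (d :: 'n \<Rightarrow> complex). invertible S \<and>
      A = S ** (\<chi> i j. if i = j then d i else 0) ** matrix_inv S)"

section \<open>Gaussian vectors and convergence in probability\<close>

definition stationary_covariance :: "real^'n^'n \<Rightarrow> real^'m^'n \<Rightarrow> real^'n^'n \<Rightarrow> bool" where
  "stationary_covariance M B C \<longleftrightarrow> M ** C + C ** transpose M = B ** transpose B"

text \<open>The second argument is the variance; variance \<open>0\<close> gives the point mass.\<close>

definition normal_law :: "real \<Rightarrow> real \<Rightarrow> real measure" where
  "normal_law m s = (if s = 0 then return borel m
                     else density lborel (\<lambda>t. ennreal (normal_density m (sqrt s) t)))"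

text \<open>
  A random vector is \<open>\<N>(m, C)\<close>-distributed iff every linear functional of it is univariate
  normal with the matching mean and variance; \<open>C\<close> may be singular.
\<close>

definition gaussian_vector ::
    "'a measure \<Rightarrow> ('a \<Rightarrow> real^'n) \<Rightarrow> real^'n \<Rightarrow> real^'n^'n \<Rightarrow> bool" where
  "gaussian_vector \<Omega> Z m C \<longleftrightarrow>
    prob_space \<Omega> \<and> Z \<in> borel_measurable \<Omega> \<and>
    transpose C = C \<and> (\<forall>a. 0 \<le> a \<bullet> (C *v a)) \<and>
    (\<forall>a. distr \<Omega> borel (\<lambda>\<omega>. a \<bullet> Z \<omega>) = normal_law (a \<bullet> m) (a \<bullet> (C *v a)))"

text \<open>
  The probability space may depend on the parameter. Measurability is part of the notion because
  \<open>measure\<close> is \<open>0\<close> on non-measurable sets.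
\<close>

definition tendsto_in_prob ::
    "('p \<Rightarrow> 'a measure) \<Rightarrow> ('p \<Rightarrow> 'a \<Rightarrow> real) \<Rightarrow> real \<Rightarrow> 'p filter \<Rightarrow> bool" where
  "tendsto_in_prob \<Omega> X l F \<longleftrightarrow>
    (\<forall>\<^sub>F p in F. X p \<in> borel_measurable (\<Omega> p)) \<and>
    (\<forall>\<epsilon>>0. ((\<lambda>p. measure (\<Omega> p) {\<omega> \<in> space (\<Omega> p). \<bar>X p \<omega> - l\<bar> > \<epsilon>}) \<longlongrightarrow> 0) F)"

section \<open>Spatial statistics\<close>

definition spatial_mean :: "real^'n \<Rightarrow> real" where
  "spatial_mean u = (\<Sum>i\<in>UNIV. u $ i) / real CARD('n)"

definition central_moment :: "nat \<Rightarrow> real^'n \<Rightarrow> real" where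
  "central_moment k u = (\<Sum>i\<in>UNIV. (u $ i - spatial_mean u) ^ k) / real CARD('n)"

definition skewness :: "real^'n \<Rightarrow> real" where
  "skewness u = central_moment 3 u / central_moment 2 u powr (3 / 2)"

definition kurtosis :: "real^'n \<Rightarrow> real" where
  "kurtosis u = central_moment 4 u / (central_moment 2 u)\<^sup>2"

definition total_weight :: "real^'n^'n \<Rightarrow> real" where
  "total_weight A = (\<Sum>i\<in>UNIV. \<Sum>j\<in>UNIV. A $ i $ j)"

definition moran_I :: "real^'n^'n \<Rightarrow> real^'n \<Rightarrow> real" where
  "moran_I A u = real CARD('n) / total_weight A *
     ((\<Sum>i\<in>UNIV. \<Sum>j\<in>UNIV. A $ i $ j * (u $ i - spatial_mean u) * (u $ j - spatial_mean u)) /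
      (\<Sum>i\<in>UNIV. (u $ i - spatial_mean u)\<^sup>2))"

definition centering :: "real^'n^'n" where
  "centering = mat 1 - (\<chi> i j. 1 / real CARD('n))"

end

(*
  Write z = g v + r with g = w.z. The Lyapunov equation gives Var g = w.BB^T w / (2 lambda_1),
  which diverges, whereas the covariance Q C Q^T of r, Q = I - v w^T, stays bounded. Hence
  (x^* - q + z)/g -> v_c in probability for every fixed q, and the statistics, which are scale
  invariant up to the sign of g and continuous at v_c, converge.

  The bound on Q C Q^T must not depend on the conditioning of the eigenbasis. The matrix Q C Q^T
  also solves the Lyapunov equation of N = M + v w^T, which converges to some N_c. Diagonalizing,
  the determinant of X |-> N X + X N^T is the product of the sums of two eigenvalues of N, and is
  therefore bounded away from 0. By continuity the operator of N_c is invertible, so the operators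
  of N are uniformly bounded below.
*)
theory Submission
  imports Defs
begin


section \<open>Kronecker sums and the Lyapunov operator\<close>

text \<open>The obstacle is that diagonalizability is given only before \<alpha>c: the diagonalizing
  matrices may degenerate in the limit, so no estimate may contain them. A determinant sees only
  eigenvalues and is continuous in the matrix, so its lower bound survives the limit even if the
  limiting matrix is not diagonalizable. The rank-one term is there because the Lyapunov operator of
  M itself has the eigenvalue 2 lambda_1, which tends to 0; adding v w^T moves lambda_1 to lambda_1
  + 1 and keeps the rest of the spectrum. The limit of M comes from smoothness of F at the endpoint
  of the branch. On the probabilistic side only one-dimensional marginals enter: a small-ball bound
  for g and Chebyshev's inequality for each coordinate of r, whatever their correlation. The sign in
  the theorem is that of \<gamma>, which differs from g by an eventually bounded number; since the
  modulus of g diverges in probability, the two signs agree outside an event of vanishing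
  probability.\<close>

lemma matrix_mult_add_right:
  fixes A B :: "'a::semiring_1^'k^'n"
  shows "(A + B) ** C = A ** C + B ** C"
  by (simp add: matrix_matrix_mult_def vec_eq_iff distrib_right sum.distrib)

text \<open>Pairs serve as row and column indices, which avoids index arithmetic for blocks and lets
  \<open>det\<close> apply to the result directly.\<close>

definition kronecker_product :: "'a::comm_ring_1^'n^'n \<Rightarrow> 'a^'n^'n \<Rightarrow> 'a^('n \<times> 'n)^('n \<times> 'n)" where
  "kronecker_product A B = (\<chi> p q. A $ fst p $ fst q * B $ snd p $ snd q)"

definition kronecker_sum :: "'a::comm_ring_1^'n^'n \<Rightarrow> 'a^('n \<times> 'n)^('n \<times> 'n)" where
  "kronecker_sum N = kronecker_product N (mat 1) + kronecker_product (mat 1) N"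

abbreviation diagonal_matrix :: "('n \<Rightarrow> 'a::zero) \<Rightarrow> 'a^'n^'n" where
  "diagonal_matrix d \<equiv> \<chi> i j. if i = j then d i else 0"

lemma kronecker_product_mult:
  "kronecker_product (A ** A') (B ** B') = kronecker_product A B ** kronecker_product A' B'"
  by (simp add: kronecker_product_def matrix_matrix_mult_def vec_eq_iff sum_product
      sum.cartesian_product case_prod_unfold UNIV_Times_UNIV[symmetric] mult_ac
      del: UNIV_Times_UNIV)

lemma kronecker_product_mat_1: "kronecker_product (mat 1) (mat 1) = mat 1"
  by (auto simp: kronecker_product_def mat_def vec_eq_iff prod_eq_iff)

lemma det_conjugate:
  fixes S T X :: "'a::comm_ring_1^'n^'n"
  assumes "S ** T = mat 1"
  shows "det (S ** X ** T) = det X"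
proof -
  have "det (S ** X ** T) = det X * det (S ** T)"
    by (simp only: det_mul mult_ac)
  then show ?thesis
    by (simp add: assms)
qed

text \<open>By the mixed-product rule the Kronecker square of \<open>S\<close> diagonalizes both
  summands at once, and its determinant cancels against that of the Kronecker square of
  \<open>T\<close>.\<close>

lemma det_kronecker_sum_diagonalized:
  fixes S T :: "'a::comm_ring_1^'n^'n"
  assumes ST: "S ** T = mat 1" and N: "N = S ** diagonal_matrix d ** T"
  shows "det (kronecker_sum N) = (\<Prod>p\<in>UNIV. d (fst p) + d (snd p))"
proof -
  let ?D = "diagonal_matrix d :: 'a^'n^'n" and ?K = kronecker_product
  have 1: "?K N (mat 1) = ?K S S ** ?K ?D (mat 1) ** ?K T T"
    by (simp add: kronecker_product_mult[symmetric] N ST)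
  have 2: "?K (mat 1) N = ?K S S ** ?K (mat 1) ?D ** ?K T T"
    by (simp add: kronecker_product_mult[symmetric] N ST)
  have sum: "kronecker_sum N = ?K S S ** (?K ?D (mat 1) + ?K (mat 1) ?D) ** ?K T T"
    unfolding kronecker_sum_def 1 2 by (simp add: matrix_add_ldistrib matrix_mult_add_right)
  have diag: "?K ?D (mat 1) + ?K (mat 1) ?D = diagonal_matrix (\<lambda>p. d (fst p) + d (snd p))"
    by (auto simp: kronecker_product_def mat_def vec_eq_iff prod_eq_iff)
  have "?K S S ** ?K T T = mat 1"
    by (simp add: kronecker_product_mult[symmetric] ST kronecker_product_mat_1)
  then have "det (kronecker_sum N) = det (?K ?D (mat 1) + ?K (mat 1) ?D)"
    unfolding sum by (rule det_conjugate)
  also have "\<dots> = (\<Prod>p\<in>UNIV. d (fst p) + d (snd p))"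
    unfolding diag by (subst det_diagonal) auto
  finally show ?thesis .
qed

lemma sum_UNIV_prod:
  fixes f :: "'a::finite \<times> 'b::finite \<Rightarrow> 'c::comm_monoid_add"
  shows "(\<Sum>q\<in>UNIV. f q) = (\<Sum>a\<in>UNIV. \<Sum>b\<in>UNIV. f (a, b))"
  using sum.cartesian_product[of "\<lambda>a b. f (a, b)" UNIV UNIV] by simp

definition lyapunov_map :: "real^'n^'n \<Rightarrow> real^'n^'n \<Rightarrow> real^'n^'n" where
  "lyapunov_map N X = N ** X + X ** transpose N"

text \<open>Vectorization links the determinant to the operator: acting on the first index of
  \<open>X\<close> is multiplication by \<open>N\<close> from the left, acting on the second index
  is multiplication by \<open>transpose N\<close> from the right.\<close>

lemma kronecker_sum_mult_vec:
  "kronecker_sum N *v (\<chi> p. X $ fst p $ snd p) = (\<chi> p. lyapunov_map N X $ fst p $ snd p)"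
proof -
  have "(\<Sum>q\<in>UNIV. kronecker_product N (mat 1) $ p $ q * X $ fst q $ snd q)
      = (N ** X) $ fst p $ snd p" for p
    by (simp add: sum_UNIV_prod kronecker_product_def matrix_matrix_mult_def mat_def if_distrib
        if_distribR cong: if_cong)
  \<comment> \<open>Here the identity sits on the outer index of the double sum; the swap makes it
    the inner one, so that the sum collapses.\<close>
  moreover have "(\<Sum>q\<in>UNIV. kronecker_product (mat 1) N $ p $ q * X $ fst q $ snd q)
      = (X ** transpose N) $ fst p $ snd p" for p
    by (subst sum_UNIV_prod, subst sum.swap)
      (simp add: kronecker_product_def matrix_matrix_mult_def mat_def transpose_def if_distrib
        if_distribR mult.commute cong: if_cong)
  ultimately show ?thesis
    by (simp add: matrix_vector_mult_def vec_eq_iff kronecker_sum_def lyapunov_map_def sum.distrib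
        distrib_right)
qed

lemma lyapunov_map_injective:
  assumes "det (kronecker_sum N) \<noteq> 0" "lyapunov_map N X = 0"
  shows "X = 0"
proof -
  have "kronecker_sum N *v (\<chi> p. X $ fst p $ snd p) = 0"
    unfolding kronecker_sum_mult_vec assms(2) by (simp add: vec_eq_iff)
  moreover obtain L where "L ** kronecker_sum N = mat 1"
    using assms(1) by (auto simp: invertible_det_nz[symmetric] invertible_def)
  then have "(\<chi> p. X $ fst p $ snd p) = L *v (kronecker_sum N *v (\<chi> p. X $ fst p $ snd p))"
    by (simp add: matrix_vector_mul_assoc)
  ultimately have "(\<chi> p. X $ fst p $ snd p) = 0"
    by simp
  then show ?thesis
    by (simp add: vec_eq_iff)
qed

section \<open>Continuity and boundedness of matrix operations\<close>

lemma tendsto_det: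
  fixes f :: "'b \<Rightarrow> real^'n^'n"
  assumes "(f \<longlongrightarrow> a) F"
  shows "((\<lambda>x. det (f x)) \<longlongrightarrow> det a) F"
  unfolding det_def by (intro tendsto_intros assms)

lemma tendsto_matrix_mult:
  fixes f :: "'b \<Rightarrow> real^'k^'n" and g :: "'b \<Rightarrow> real^'m^'k"
  assumes "(f \<longlongrightarrow> a) F" "(g \<longlongrightarrow> c) F"
  shows "((\<lambda>x. f x ** g x) \<longlongrightarrow> a ** c) F"
  using assms unfolding matrix_matrix_mult_def
  by (intro vec_tendstoI) (auto intro!: tendsto_intros)

lemma tendsto_transpose:
  fixes f :: "'b \<Rightarrow> real^'k^'n"
  assumes "(f \<longlongrightarrow> a) F"
  shows "((\<lambda>x. transpose (f x)) \<longlongrightarrow> transpose a) F"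
  using assms unfolding transpose_def
  by (intro vec_tendstoI) (auto intro!: tendsto_intros)

lemma tendsto_kronecker_sum:
  fixes f :: "'b \<Rightarrow> real^'n^'n"
  assumes "(f \<longlongrightarrow> a) F"
  shows "((\<lambda>x. kronecker_sum (f x)) \<longlongrightarrow> kronecker_sum a) F"
  using assms unfolding kronecker_sum_def kronecker_product_def
  by (intro tendsto_add vec_tendstoI) (auto intro!: tendsto_intros)

text \<open>Multiplication is bilinear on finite-dimensional spaces, hence bounded. Some constant is
  all that the perturbation of the Lyapunov operator uses.\<close>

lemma norm_matrix_mult_le:
  "\<exists>K>0. \<forall>(X::real^'k^'n) (Y::real^'m^'k). norm (X ** Y) \<le> norm X * norm Y * K"
proof -
  have "bilinear ((**) :: real^'k^'n \<Rightarrow> real^'m^'k \<Rightarrow> real^'m^'n)"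
    unfolding bilinear_def
    by (auto intro!: linearI simp: matrix_add_ldistrib matrix_mult_add_right
        matrix_scalar_ac scalar_matrix_assoc)
  then have "bounded_bilinear ((**) :: real^'k^'n \<Rightarrow> real^'m^'k \<Rightarrow> real^'m^'n)"
    by (simp add: bilinear_conv_bounded_bilinear)
  then show ?thesis using bounded_bilinear.pos_bounded by blast
qed


section \<open>Deflating a simple eigenvalue\<close>

definition outer_product :: "'a::times^'n \<Rightarrow> 'a^'m \<Rightarrow> 'a^'m^'n" where
  "outer_product v w = (\<chi> i j. v $ i * w $ j)"

lemma diagonal_matrix_mult_vec:
  "diagonal_matrix d *v a = (\<chi> i. d i * a $ i)" for a :: "'a::semiring_1^'n"
  by (simp add: matrix_vector_mult_def vec_eq_iff if_distrib if_distribR cong: if_cong)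

lemma vec_mult_diagonal_matrix:
  "a v* diagonal_matrix d = (\<chi> i. a $ i * d i)" for a :: "'a::semiring_1^'n"
  by (simp add: vector_matrix_mult_def vec_eq_iff if_distrib if_distribR cong: if_cong)

lemma scalar_vector_matrix_assoc: "(c *s a) v* A = c *s (a v* A)"
  for a :: "'a::comm_semiring_1^'n"
  by (simp add: vector_matrix_mult_def vec_eq_iff sum_distrib_left mult_ac)

lemma outer_product_matrix_mult:
  "A ** outer_product a c ** B = outer_product (A *v a) (c v* B)"
  for A B :: "'a::comm_semiring_1^'n^'n"
  unfolding matrix_matrix_mult_def matrix_vector_mult_def vector_matrix_mult_def outer_product_def
  by (simp add: vec_eq_iff sum_distrib_left sum_distrib_right mult_ac)

section \<open>Characteristic polynomials and eigenvalues of diagonalized matrices\<close>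

lemma const_poly_sum: "[:sum f A:] = (\<Sum>x\<in>A. [:f x:])"
  by (induction A rule: infinite_finite_induct) (simp_all, metis add_pCons add_0_left)

lemma map_matrix_const_poly_mult:
  fixes A B :: "'a::comm_semiring_1^'n^'n"
  shows "map_matrix (\<lambda>a. [:a:]) (A ** B) = map_matrix (\<lambda>a. [:a:]) A ** map_matrix (\<lambda>a. [:a:]) B"
  by (simp add: matrix_matrix_mult_def vec_eq_iff const_poly_sum mult.commute)

lemma mat_mult_commute: "mat k ** A = A ** mat k" for A :: "'a::comm_semiring_1^'n^'n"
  by (simp add: matrix_matrix_mult_def mat_def vec_eq_iff if_distrib if_distribR mult.commute cong: if_cong)

text \<open>Conjugation by \<open>S\<close> passes to matrices of constant polynomials, and the
  scalar matrix of the indeterminate commutes with everything, so the characteristic matrix is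
  conjugate to a diagonal one.\<close>

lemma char_polynomial_diagonalized:
  fixes S T :: "complex^'n^'n"
  assumes ST: "S ** T = mat 1" and A: "A = S ** diagonal_matrix d ** T"
  shows "char_polynomial A = (\<Prod>i\<in>UNIV. [:- d i, 1:])"
proof -
  let ?c = "map_matrix (\<lambda>a::complex. [:a:]) :: complex^'n^'n \<Rightarrow> _"
  let ?D = "diagonal_matrix (\<lambda>i. [:- d i, 1:]) :: complex poly^'n^'n"
  have 1: "?c S ** ?c T = mat 1"
    by (simp add: map_matrix_const_poly_mult[symmetric] ST) (auto simp: vec_eq_iff mat_def)
  have "mat [:0, 1:] = ?D + ?c (diagonal_matrix d)"
    by (auto simp: vec_eq_iff mat_def)
  then have "?c S ** ?D ** ?c T + ?c A = ?c S ** mat [:0, 1:] ** ?c T"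
    by (simp add: A map_matrix_const_poly_mult matrix_add_ldistrib matrix_mult_add_right)
  also have "\<dots> = mat [:0, 1:]"
    by (simp add: mat_mult_commute[of _ "?c S", symmetric] matrix_mul_assoc[symmetric] 1)
  finally have eq: "mat [:0, 1:] - ?c A = ?c S ** ?D ** ?c T"
    by (simp add: algebra_simps)
  have "char_polynomial A = det ?D"
    unfolding char_polynomial_def eq using 1 by (rule det_conjugate)
  also have "\<dots> = (\<Prod>i\<in>UNIV. [:- d i, 1:])"
    by (subst det_diagonal) auto
  finally show ?thesis .
qed

text \<open>Two indices carrying \<open>\<mu>\<close> would contribute the square of a linear
  factor. This turns algebraic simplicity into uniqueness of a diagonal entry.\<close>

lemma simple_root_unique:
  fixes d :: "'n::finite \<Rightarrow> complex"
  assumes "order \<mu> (\<Prod>i\<in>UNIV. [:- d i, 1:]) = 1" "d i = \<mu>" "d j = \<mu>"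
  shows "i = j"
proof (rule ccontr)
  assume "i \<noteq> j"
  let ?p = "\<Prod>i\<in>UNIV. [:- d i, 1:]"
  have "?p = [:- d i, 1:] * ([:- d j, 1:] * (\<Prod>k\<in>UNIV - {i} - {j}. [:- d k, 1:]))"
    using \<open>i \<noteq> j\<close> by (simp add: prod.remove[of UNIV i] prod.remove[of "UNIV - {i}" j])
  then have "[:- \<mu>, 1:] ^ 2 dvd ?p"
    using assms(2,3) by (simp only: power2_eq_square mult.assoc[symmetric] dvd_triv_left)
  moreover have "?p \<noteq> 0"
    by simp
  ultimately have "2 \<le> order \<mu> ?p"
    using order_divides by blast
  with assms(1) show False
    by simp
qed

lemma matrix_inv_both:
  assumes "invertible S"
  shows "S ** matrix_inv S = mat 1" "matrix_inv S ** S = mat 1"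
  using someI_ex[OF assms[unfolded invertible_def]] unfolding matrix_inv_def by auto

text \<open>The \<open>i\<close>-th column of \<open>S\<close> is an eigenvector. Hypotheses about
  all eigenvalues thereby apply to the diagonal entries.\<close>

lemma eigenvalue_diagonalized:
  fixes S T :: "complex^'n^'n"
  assumes TS: "T ** S = mat 1" and A: "A = S ** diagonal_matrix d ** T"
  shows "eigenvalue A (d i)"
proof -
  let ?e = "axis i 1 :: complex^'n"
  have De: "diagonal_matrix d *v ?e = d i *s ?e"
    by (auto simp: diagonal_matrix_mult_vec vec_eq_iff axis_def)
  have "A *v (S *v ?e) = S *v (diagonal_matrix d *v (T *v (S *v ?e)))"
    by (simp add: A matrix_vector_mul_assoc matrix_mul_assoc)
  also have "\<dots> = S *v (diagonal_matrix d *v ?e)"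
    by (simp add: matrix_vector_mul_assoc[of T] TS)
  also have "\<dots> = d i *s (S *v ?e)"
    by (simp add: De vector_scalar_commute)
  finally have "A *v (S *v ?e) = d i *s (S *v ?e)" .
  moreover have "S *v ?e \<noteq> 0"
  proof
    assume "S *v ?e = 0"
    then have "T *v (S *v ?e) = 0" by simp
    then show False by (simp add: matrix_vector_mul_assoc TS axis_eq_0_iff)
  qed
  ultimately show ?thesis
    unfolding eigenvalue_def by blast
qed

lemma det_complex_matrix: "det (complex_matrix A) = complex_of_real (det A)"
  by (simp add: det_def complex_matrix_def)

lemma kronecker_sum_complex_matrix:
  "kronecker_sum (complex_matrix A) = complex_matrix (kronecker_sum A)"
  by (simp add: kronecker_sum_def kronecker_product_def complex_matrix_def vec_eq_iff mat_def)

text \<open>In the eigenbasis the coordinates \<open>a\<close> of the right and \<open>c\<close> of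
  the left eigenvector vanish at every index with \<open>d i \<noteq> \<mu>\<close>. Simplicity
  leaves a single index, and the normalization makes the product of the two surviving coordinates 1.
  So the rank-one term becomes a diagonal matrix unit, and \<open>S\<close> diagonalizes the sum as
  well.\<close>

lemma deflation_diagonalized:
  fixes S T A :: "complex^'n^'n" and v w :: "complex^'n"
  assumes ST: "S ** T = mat 1" and TS: "T ** S = mat 1"
    and A: "A = S ** diagonal_matrix d ** T"
    and simple: "order \<mu> (char_polynomial A) = 1"
    and v: "A *v v = \<mu> *s v" and w: "w v* A = \<mu> *s w" and wv: "(\<Sum>i\<in>UNIV. w $ i * v $ i) = 1"
  obtains i0 where "d i0 = \<mu>" "\<And>i. i \<noteq> i0 \<Longrightarrow> d i \<noteq> \<mu>"
    "A + outer_product v w = S ** diagonal_matrix (\<lambda>i. d i + (if i = i0 then 1 else 0)) ** T"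
proof -
  define a where "a = T *v v"
  define c where "c = w v* S"
  have TA: "T ** A = diagonal_matrix d ** T"
    by (simp add: A matrix_mul_assoc TS)
  have AS: "A ** S = S ** diagonal_matrix d"
    by (simp add: A matrix_mul_assoc[symmetric] TS)
  have "diagonal_matrix d *v a = T *v (A *v v)"
    by (simp add: a_def matrix_vector_mul_assoc TA)
  then have "diagonal_matrix d *v a = \<mu> *s a"
    by (simp add: v a_def vector_scalar_commute)
  then have da: "a $ i = 0" if "d i \<noteq> \<mu>" for i
    using that by (auto simp: diagonal_matrix_mult_vec vec_eq_iff)
  have "c v* diagonal_matrix d = (w v* A) v* S"
    by (simp add: c_def vector_matrix_mul_assoc AS)
  then have "c v* diagonal_matrix d = \<mu> *s c"
    by (simp add: w c_def scalar_vector_matrix_assoc)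
  then have dc: "c $ i = 0" if "d i \<noteq> \<mu>" for i
    using that by (auto simp: vec_mult_diagonal_matrix vec_eq_iff mult.commute)
  have Sa: "S *v a = v" and cT: "c v* T = w"
    by (simp_all add: a_def c_def matrix_vector_mul_assoc vector_matrix_mul_assoc ST)
  have "(\<Sum>i\<in>UNIV. c $ i * a $ i) = (\<Sum>i\<in>UNIV. w $ i * (S *v a) $ i)"
    unfolding c_def vector_matrix_mult_def matrix_vector_mult_def
    by (simp add: sum_distrib_left sum_distrib_right mult_ac) (rule sum.swap)
  then have ca: "(\<Sum>i\<in>UNIV. c $ i * a $ i) = 1"
    by (simp add: Sa wv)
  then obtain i0 where i0: "c $ i0 * a $ i0 \<noteq> 0"
    by (metis (no_types, lifting) sum.not_neutral_contains_not_neutral zero_neq_one)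
  have d0: "d i0 = \<mu>"
    using da[of i0] i0 by auto
  have other: "d i \<noteq> \<mu>" if "i \<noteq> i0" for i
    using simple_root_unique[OF simple[unfolded char_polynomial_diagonalized[OF ST A]]] d0 that
    by blast
  have "(\<Sum>i\<in>UNIV. c $ i * a $ i) = c $ i0 * a $ i0"
    using sum.remove[of UNIV i0 "\<lambda>i. c $ i * a $ i"] da[OF other] by simp
  then have "outer_product a c = diagonal_matrix (\<lambda>i. if i = i0 then 1 else 0)"
    using da dc other ca by (auto simp: outer_product_def vec_eq_iff mult.commute)
  then have "outer_product v w = S ** diagonal_matrix (\<lambda>i. if i = i0 then 1 else 0) ** T"
    using outer_product_matrix_mult[of S a c T] by (simp add: Sa cT)
  moreover have "diagonal_matrix d + diagonal_matrix (\<lambda>i. if i = i0 then 1 else 0)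
      = (diagonal_matrix (\<lambda>i. d i + (if i = i0 then 1 else 0)) :: complex^'n^'n)"
    by (auto simp: vec_eq_iff)
  ultimately have "A + outer_product v w
      = S ** diagonal_matrix (\<lambda>i. d i + (if i = i0 then 1 else 0)) ** T"
    by (simp add: A matrix_add_ldistrib[symmetric] matrix_mult_add_right[symmetric])
  with d0 other that show thesis
    by blast
qed

text \<open>
  Deflation replaces the small eigenvalue \<open>l\<close> by \<open>l + 1\<close>, so all eigenvalue sums
  \<open>\<nu>\<^sub>i + \<nu>\<^sub>j\<close> stay away from \<open>0\<close>, with a bound that does not involve the diagonalizing matrix.
\<close>

lemma det_kronecker_sum_deflation_ge:
  fixes M :: "real^'n^'n" and v w :: "real^'n"
  assumes diag: "diagonalizable (complex_matrix M)"
    and simple: "simple_eigenvalue (complex_matrix M) (complex_of_real l)"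
    and gap: "\<And>\<mu>. eigenvalue (complex_matrix M) \<mu> \<Longrightarrow> \<mu> \<noteq> complex_of_real l \<Longrightarrow> m \<le> Re \<mu>"
    and v: "M *v v = l *\<^sub>R v" and w: "w v* M = l *\<^sub>R w" and wv: "w \<bullet> v = 1"
    and "0 < l" "0 < m" "m \<le> 1"
  shows "m ^ CARD('n \<times> 'n) \<le> \<bar>det (kronecker_sum (M + outer_product v w))\<bar>"
proof -
  let ?M = "complex_matrix M"
  let ?cv = "\<lambda>u :: real^'n. \<chi> i. complex_of_real (u $ i)"
  obtain S :: "complex^'n^'n" and d where "invertible S" and SD: "?M = S ** diagonal_matrix d ** matrix_inv S"
    using diag unfolding diagonalizable_def by blast
  note ST = matrix_inv_both(1)[OF this(1)] and TS = matrix_inv_both(2)[OF this(1)]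
  have cv: "?M *v ?cv v = of_real l *s ?cv v"
    using arg_cong[OF v, of ?cv]
    by (simp add: complex_matrix_def matrix_vector_mult_def vec_eq_iff)
  have cw: "?cv w v* ?M = of_real l *s ?cv w"
    using arg_cong[OF w, of ?cv]
    by (simp add: complex_matrix_def vector_matrix_mult_def vec_eq_iff)
  have "(\<Sum>i\<in>UNIV. ?cv w $ i * ?cv v $ i) = complex_of_real (w \<bullet> v)"
    by (simp add: inner_vec_def)
  then have cwv: "(\<Sum>i\<in>UNIV. ?cv w $ i * ?cv v $ i) = 1"
    by (simp add: wv)
  obtain i0 where i0: "d i0 = of_real l" "\<And>i. i \<noteq> i0 \<Longrightarrow> d i \<noteq> of_real l" and
    N: "?M + outer_product (?cv v) (?cv w)
      = S ** diagonal_matrix (\<lambda>i. d i + (if i = i0 then 1 else 0)) ** matrix_inv S"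
    using deflation_diagonalized[OF ST TS SD _ cv cw cwv] simple
    unfolding simple_eigenvalue_def by blast
  let ?e = "\<lambda>i. d i + (if i = i0 then 1 else 0)"
  \<comment> \<open>At \<open>i0\<close> the entry is \<open>l + 1\<close>, which exceeds
    \<open>1\<close> and hence \<open>m\<close>; at the other indices the gap applies.\<close>
  have e: "m \<le> Re (?e i)" for i
    using gap[OF eigenvalue_diagonalized[OF TS SD], of i] i0 assms(7-9) by (cases "i = i0") auto
  have "?M + outer_product (?cv v) (?cv w) = complex_matrix (M + outer_product v w)"
    by (simp add: complex_matrix_def outer_product_def vec_eq_iff)
  then have "complex_of_real (det (kronecker_sum (M + outer_product v w)))
      = det (kronecker_sum (?M + outer_product (?cv v) (?cv w)))"
    by (simp add: det_complex_matrix[symmetric] kronecker_sum_complex_matrix)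
  also have "\<dots> = (\<Prod>p\<in>UNIV. ?e (fst p) + ?e (snd p))"
    using ST N by (rule det_kronecker_sum_diagonalized)
  finally have "cmod (complex_of_real (det (kronecker_sum (M + outer_product v w))))
      = cmod (\<Prod>p\<in>UNIV. ?e (fst p) + ?e (snd p))"
    by (rule arg_cong)
  then have "\<bar>det (kronecker_sum (M + outer_product v w))\<bar>
      = (\<Prod>p\<in>UNIV. cmod (?e (fst p) + ?e (snd p)))"
    by (simp only: norm_of_real prod_norm)
  \<comment> \<open>The modulus dominates the real part, which is at least \<open>2 * m\<close>; the
    cruder bound \<open>m\<close> is kept.\<close>
  moreover have "m \<le> cmod (?e i + ?e j)" for i j
    using e[of i] e[of j] complex_Re_le_cmod[of "?e i + ?e j"] \<open>0 < m\<close> by simp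
  then have "(\<Prod>p\<in>(UNIV::('n \<times> 'n) set). m) \<le> (\<Prod>p\<in>UNIV. cmod (?e (fst p) + ?e (snd p)))"
    using \<open>0 < m\<close> by (intro prod_mono) auto
  ultimately show ?thesis
    by simp
qed


section \<open>The stationary covariance near criticality\<close>

lemma linear_lyapunov_map: "linear (lyapunov_map N)"
  by (rule linearI) (simp_all add: lyapunov_map_def matrix_add_ldistrib matrix_mult_add_right
      matrix_scalar_ac scalar_matrix_assoc scaleR_add_right)

lemma matrix_mult_diff_left: "(A - B) ** C = A ** C - B ** C" for A B :: "real^'n^'m"
  by (simp add: matrix_matrix_mult_def vec_eq_iff left_diff_distrib sum_subtractf)

lemma matrix_mult_diff_right: "A ** (B - C) = A ** B - A ** C" for A :: "real^'n^'m"
  by (simp add: matrix_matrix_mult_def vec_eq_iff right_diff_distrib sum_subtractf)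

lemma transpose_diff: "transpose (A - B) = transpose A - transpose B" for A :: "real^'n^'m"
  by (simp add: transpose_def vec_eq_iff)

lemma transpose_0: "transpose (0 :: real^'n^'m) = 0"
  by (simp add: transpose_def vec_eq_iff)

lemma lyapunov_map_diff_left: "lyapunov_map (N - N') X = lyapunov_map N X - lyapunov_map N' X"
  by (simp add: lyapunov_map_def transpose_diff matrix_mult_diff_left matrix_mult_diff_right)

text \<open>In finite dimension, injectivity of the limiting operator is a quantitative lower bound,
  and such a bound is stable under small perturbations of \<open>N\<close>. One constant then serves
  all parameters close to the limit.\<close>

lemma lyapunov_map_bounded_below:
  fixes N :: "'b \<Rightarrow> real^'n^'n"
  assumes lim: "(N \<longlongrightarrow> N0) F" and det: "det (kronecker_sum N0) \<noteq> 0"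
  obtains c where "c > 0" "\<forall>\<^sub>F x in F. \<forall>X. c * norm X \<le> norm (lyapunov_map (N x) X)"
proof -
  have "inj (lyapunov_map N0)"
    using lyapunov_map_injective[OF det] by (simp add: linear_injective_0[OF linear_lyapunov_map])
  then obtain c where c: "c > 0" "\<And>X. c * norm X \<le> norm (lyapunov_map N0 X)"
    using linear_inj_bounded_below_pos[OF linear_lyapunov_map] by blast
  obtain K where K: "K > 0" "\<And>(X :: real^'n^'n) (Y :: real^'n^'n). norm (X ** Y) \<le> norm X * norm Y * K"
    using norm_matrix_mult_le by blast
  have "((\<lambda>x. (norm (N0 - N x) + norm (transpose (N0 - N x))) * K) \<longlongrightarrow> 
      (norm (N0 - N0) + norm (transpose (N0 - N0))) * K) F"
    by (intro tendsto_intros tendsto_transpose lim)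
  then have "((\<lambda>x. (norm (N0 - N x) + norm (transpose (N0 - N x))) * K) \<longlongrightarrow> 0) F"
    by (simp add: transpose_0)
  \<comment> \<open>Half of \<open>c\<close> is spent on the perturbation; the other half remains as
    the lower bound.\<close>
  then have "\<forall>\<^sub>F x in F. (norm (N0 - N x) + norm (transpose (N0 - N x))) * K < c / 2"
    using c(1) by (intro order_tendstoD(2)[where y=0]) auto
  then have "\<forall>\<^sub>F x in F. \<forall>X. c / 2 * norm X \<le> norm (lyapunov_map (N x) X)"
  proof eventually_elim
    case (elim x)
    show ?case
    proof
      fix X
      have "norm (lyapunov_map (N0 - N x) X)
          \<le> norm ((N0 - N x) ** X) + norm (X ** transpose (N0 - N x))"
        unfolding lyapunov_map_def by (rule norm_triangle_ineq)
      also have "\<dots> \<le> (norm (N0 - N x) + norm (transpose (N0 - N x))) * K * norm X"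
        using K(2)[of "N0 - N x" X] K(2)[of X "transpose (N0 - N x)"] by (simp add: algebra_simps)
      also have "\<dots> \<le> c / 2 * norm X"
        using elim by (intro mult_right_mono) auto
      finally show "c / 2 * norm X \<le> norm (lyapunov_map (N x) X)"
        using c(2)[of X] norm_triangle_sub[of "lyapunov_map N0 X" "lyapunov_map (N x) X"]
        by (simp add: lyapunov_map_diff_left)
    qed
  qed
  with c(1) that[of "c / 2"] show thesis
    by simp
qed

text \<open>For left and right eigenvectors with \<open>w \<bullet> v = 1\<close> this is the
  spectral projection removing the critical direction: its kernel is spanned by \<open>v\<close>,
  its range is the kernel of \<open>w\<close>.\<close>

definition deflation_projection :: "real^'n \<Rightarrow> real^'n \<Rightarrow> real^'n^'n" where
  "deflation_projection v w = mat 1 - outer_product v w"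

lemma matrix_mult_outer_product: "A ** outer_product v w = outer_product (A *v v) w"
  for A :: "real^'n^'n"
  by (simp add: outer_product_def matrix_matrix_mult_def matrix_vector_mult_def vec_eq_iff
      sum_distrib_left sum_distrib_right mult_ac)

lemma outer_product_mult_matrix: "outer_product v w ** A = outer_product v (w v* A)"
  for A :: "real^'n^'n"
  by (simp add: outer_product_def matrix_matrix_mult_def vector_matrix_mult_def vec_eq_iff
      sum_distrib_left sum_distrib_right mult_ac)

text \<open>
  \<open>w\<close> annihilates the range of the projection, so the covariance of the transverse part
  solves the Lyapunov equation of \<open>M\<close> and of its deflation alike.
\<close>

lemma lyapunov_map_deflation:
  fixes M C v w B
  defines "Q \<equiv> deflation_projection v w"
  assumes cov: "stationary_covariance M B C"
    and v: "M *v v = l *\<^sub>R v" and w: "w v* M = l *\<^sub>R w" and wv: "w \<bullet> v = 1"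
  shows "lyapunov_map (M + outer_product v w) (Q ** C ** transpose Q)
      = Q ** (B ** transpose B) ** transpose Q"
proof -
  have "w v* outer_product v w = (w \<bullet> v) *\<^sub>R w"
    by (simp add: inner_vec_def vector_matrix_mult_def outer_product_def vec_eq_iff
        sum_distrib_right mult.assoc)
  then have "w v* outer_product v w = w"
    by (simp add: wv)
  then have OQ: "outer_product v w ** Q = 0"
    by (simp add: Q_def deflation_projection_def matrix_mult_diff_right outer_product_mult_matrix)
  have "outer_product (l *\<^sub>R v) w = outer_product v (l *\<^sub>R w)"
    by (simp add: outer_product_def vec_eq_iff)
  \<comment> \<open>The rank-one part commutes with \<open>M\<close>, since both products equal
    \<open>l\<close> times \<open>outer_product v w\<close>.\<close>
  then have "M ** Q = Q ** M"
    by (simp add: Q_def deflation_projection_def matrix_mult_diff_right matrix_mult_diff_left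
        outer_product_mult_matrix matrix_mult_outer_product v w)
  then have NQ: "(M + outer_product v w) ** Q = Q ** M"
    by (simp add: matrix_mult_add_right OQ)
  then have "transpose Q ** transpose (M + outer_product v w) = transpose M ** transpose Q"
    by (simp flip: matrix_transpose_mul)
  then have "lyapunov_map (M + outer_product v w) (Q ** C ** transpose Q)
      = Q ** M ** C ** transpose Q + Q ** C ** transpose M ** transpose Q"
    unfolding lyapunov_map_def by (simp add: matrix_mul_assoc NQ) (simp add: matrix_mul_assoc[symmetric])
  also have "\<dots> = Q ** (M ** C + C ** transpose M) ** transpose Q"
    by (simp add: matrix_add_ldistrib matrix_mult_add_right matrix_mul_assoc)
  finally show ?thesis
    using cov by (simp add: stationary_covariance_def)
qed

text \<open>Testing the Lyapunov equation with the left eigenvector on both sides turns each of its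
  two terms into \<open>l\<close> times the critical variance.\<close>

lemma critical_variance:
  assumes cov: "stationary_covariance M B C"
    and w: "w v* M = l *\<^sub>R w" and "l > 0"
  shows "w \<bullet> (C *v w) = (w \<bullet> ((B ** transpose B) *v w)) / (2 * l)"
proof -
  have 1: "w \<bullet> ((M ** C) *v w) = l * (w \<bullet> (C *v w))"
    by (simp add: matrix_vector_mul_assoc[symmetric] dot_lmul_matrix[of w M, symmetric] w)
  have 2: "w \<bullet> ((C ** transpose M) *v w) = l * (w \<bullet> (C *v w))"
    by (simp add: matrix_vector_mul_assoc[symmetric] w matrix_vector_mult_scaleR)
  have "w \<bullet> ((B ** transpose B) *v w) = 2 * l * (w \<bullet> (C *v w))"
    using cov[unfolded stationary_covariance_def, symmetric] 1 2
    by (simp add: matrix_vector_mult_add_rdistrib inner_add_right)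
  with \<open>l > 0\<close> show ?thesis by simp
qed

text \<open>The derivative in the state is the joint derivative restricted to increments
  \<open>(h, 0)\<close>, and the joint derivative is itself differentiable, hence continuous, at the
  endpoint of the branch.\<close>

lemma tendsto_jacobian:
  fixes F :: "real^'n \<Rightarrow> real \<Rightarrow> real^'n"
  assumes C2: "C2_on (\<lambda>(p, \<alpha>). F p \<alpha>) U" and xc: "(xc, \<alpha>c) \<in> U"
    and xs: "(xs \<longlongrightarrow> xc) (at_left \<alpha>c)" and inU: "\<forall>\<^sub>F \<alpha> in at_left \<alpha>c. (xs \<alpha>, \<alpha>) \<in> U"
  obtains J where "((\<lambda>\<alpha>. jacobian (\<lambda>p. F p \<alpha>) (at (xs \<alpha>))) \<longlongrightarrow> J) (at_left \<alpha>c)"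
proof -
  obtain D D2 where D: "\<And>p. p \<in> U \<Longrightarrow> ((\<lambda>(p, \<alpha>). F p \<alpha>) has_derivative blinfun_apply (D p)) (at p)"
    and D2: "\<And>p. p \<in> U \<Longrightarrow> (D has_derivative blinfun_apply (D2 p)) (at p)"
    using C2 unfolding C2_on_def by (elim conjE exE) (rule that, auto)
  have jac: "jacobian (\<lambda>p. F p \<alpha>) (at p) = matrix (\<lambda>h. blinfun_apply (D (p, \<alpha>)) (h, 0))"
    if "(p, \<alpha>) \<in> U" for p \<alpha>
  proof -
    have "((\<lambda>q. (q, \<alpha>)) has_derivative (\<lambda>h. (h, 0))) (at p)"
      by (intro has_derivative_Pair has_derivative_ident has_derivative_const)
    from has_derivative_compose[OF this D[OF that]]
    have "((\<lambda>q. F q \<alpha>) has_derivative (\<lambda>h. blinfun_apply (D (p, \<alpha>)) (h, 0))) (at p)"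
      by simp
    then show ?thesis
      unfolding jacobian_def by (rule arg_cong[OF frechet_derivative_at[symmetric]])
  qed
  have "continuous (at (xc, \<alpha>c)) D"
    using D2[OF xc] by (rule has_derivative_continuous)
  moreover have "((\<lambda>\<alpha>. (xs \<alpha>, \<alpha>)) \<longlongrightarrow> (xc, \<alpha>c)) (at_left \<alpha>c)"
    by (intro tendsto_Pair xs tendsto_ident_at)
  ultimately have lim: "((\<lambda>\<alpha>. D (xs \<alpha>, \<alpha>)) \<longlongrightarrow> D (xc, \<alpha>c)) (at_left \<alpha>c)"
    by (rule isCont_tendsto_compose)
  have "((\<lambda>\<alpha>. blinfun_apply (D (xs \<alpha>, \<alpha>)) h $ i)
      \<longlongrightarrow> blinfun_apply (D (xc, \<alpha>c)) h $ i) (at_left \<alpha>c)" for h i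
    by (rule tendsto_vec_nth[OF bounded_bilinear.tendsto[OF bounded_bilinear_blinfun_apply lim tendsto_const]])
  then have "((\<lambda>\<alpha>. matrix (\<lambda>h. blinfun_apply (D (xs \<alpha>, \<alpha>)) (h, 0)))
      \<longlongrightarrow> matrix (\<lambda>h. blinfun_apply (D (xc, \<alpha>c)) (h, 0))) (at_left \<alpha>c)"
    unfolding matrix_def
    by (intro vec_tendstoI) simp
  moreover have "\<forall>\<^sub>F \<alpha> in at_left \<alpha>c. matrix (\<lambda>h. blinfun_apply (D (xs \<alpha>, \<alpha>)) (h, 0))
      = jacobian (\<lambda>p. F p \<alpha>) (at (xs \<alpha>))"
    using inU by eventually_elim (simp add: jac)
  ultimately show thesis
    by (rule that[OF Lim_transform_eventually])
qed

text \<open>The determinant bound is a closed condition, so it passes to the limit of the deflated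
  matrices. The uniform lower bound that follows is then applied to the transverse Lyapunov
  equation, whose right-hand side converges.\<close>

lemma transverse_covariance_bounded:
  fixes M C :: "'b \<Rightarrow> real^'n^'n" and v w :: "'b \<Rightarrow> real^'n" and B :: "real^'m^'n"
  defines "Q \<equiv> \<lambda>x. deflation_projection (v x) (w x)"
  assumes nt: "F \<noteq> bot" and "0 < \<delta>" 
    and M: "(M \<longlongrightarrow> Mc) F" and v: "(v \<longlongrightarrow> vc) F" and w: "(w \<longlongrightarrow> wc) F"
    and cov: "\<forall>\<^sub>F x in F. stationary_covariance (M x) B (C x)"
    and diag: "\<forall>\<^sub>F x in F. diagonalizable (complex_matrix (M x))"
    and simple: "\<forall>\<^sub>F x in F. simple_eigenvalue (complex_matrix (M x)) (complex_of_real (l x))"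
    and gap: "\<forall>\<^sub>F x in F. \<forall>\<mu>. eigenvalue (complex_matrix (M x)) \<mu> \<and> \<mu> \<noteq> complex_of_real (l x)
      \<longrightarrow> \<delta> \<le> Re \<mu>"
    and pos: "\<forall>\<^sub>F x in F. 0 < l x"
    and v_eig: "\<forall>\<^sub>F x in F. M x *v v x = l x *\<^sub>R v x"
    and w_eig: "\<forall>\<^sub>F x in F. w x v* M x = l x *\<^sub>R w x"
    and wv: "\<forall>\<^sub>F x in F. w x \<bullet> v x = 1"
  obtains K where "\<forall>\<^sub>F x in F. norm (Q x ** C x ** transpose (Q x)) \<le> K"
proof -
  let ?N = "\<lambda>x. M x + outer_product (v x) (w x)" and ?L = "Mc + outer_product vc wc"
  \<comment> \<open>The deflated eigenvalue \<open>l x + 1\<close> is at least \<open>1\<close>, the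
    others have real part at least \<open>\<delta>\<close>.\<close>
  let ?m = "min 1 \<delta>"
  have outer: "((\<lambda>x. outer_product (v x) (w x)) \<longlongrightarrow> outer_product vc wc) F"
    unfolding outer_product_def by (intro vec_tendstoI) (auto intro!: tendsto_intros v w)
  then have N: "(?N \<longlongrightarrow> ?L) F"
    by (intro tendsto_add M)
  have "\<forall>\<^sub>F x in F. ?m ^ CARD('n \<times> 'n) \<le> \<bar>det (kronecker_sum (?N x))\<bar>"
    using diag simple gap pos v_eig w_eig wv
  proof eventually_elim
    case (elim x)
    show ?case
      by (rule det_kronecker_sum_deflation_ge[where l = "l x"]) (use elim \<open>0 < \<delta>\<close> in auto)
  qed
  moreover have "((\<lambda>x. \<bar>det (kronecker_sum (?N x))\<bar>) \<longlongrightarrow> \<bar>det (kronecker_sum ?L)\<bar>) F"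
    by (intro tendsto_rabs tendsto_det tendsto_kronecker_sum N)
  ultimately have "?m ^ CARD('n \<times> 'n) \<le> \<bar>det (kronecker_sum ?L)\<bar>"
    using nt tendsto_lowerbound by blast
  moreover have "0 < ?m ^ CARD('n \<times> 'n)"
    using \<open>0 < \<delta>\<close> by (intro zero_less_power) simp
  ultimately have "det (kronecker_sum ?L) \<noteq> 0"
    by linarith
  then obtain c where c: "c > 0" "\<forall>\<^sub>F x in F. \<forall>X. c * norm X \<le> norm (lyapunov_map (?N x) X)"
    using lyapunov_map_bounded_below[OF N] by blast
  let ?R = "\<lambda>v w. deflation_projection v w ** (B ** transpose B) ** transpose (deflation_projection v w)"
  have "((\<lambda>x. norm (?R (v x) (w x))) \<longlongrightarrow> norm (?R vc wc)) F"
    unfolding deflation_projection_def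
    by (intro tendsto_norm tendsto_matrix_mult tendsto_transpose tendsto_diff tendsto_const outer)
  then have "\<forall>\<^sub>F x in F. norm (?R (v x) (w x)) < norm (?R vc wc) + 1"
    by (rule order_tendstoD) simp
  with c(2) cov v_eig w_eig wv
  have "\<forall>\<^sub>F x in F. norm (Q x ** C x ** transpose (Q x)) \<le> (norm (?R vc wc) + 1) / c"
  proof eventually_elim
    case (elim x)
    have "c * norm (Q x ** C x ** transpose (Q x)) \<le> norm (?R (v x) (w x))"
      using elim(1) unfolding Q_def by (simp flip: lyapunov_map_deflation[OF elim(2-5)])
    with elim(6) \<open>c > 0\<close> show ?case
      by (simp add: field_simps)
  qed
  then show thesis
    by (rule that)
qed


section \<open>Gaussian vectors with one diverging direction\<close>

text \<open>Chebyshev's inequality. Zero variance is a separate case because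
  \<open>normal_law\<close> is then a point mass, which gives the tail measure 0.\<close>

lemma normal_law_tail:
  assumes "0 \<le> s" "0 < c"
  shows "measure (normal_law 0 s) {t. c < \<bar>t\<bar>} \<le> s / c\<^sup>2"
proof (cases "s = 0")
  case True
  then show ?thesis
    using assms by (simp add: normal_law_def measure_return)
next
  case False
  then have s: "0 < sqrt s" and ss: "(sqrt s)\<^sup>2 = s"
    using assms by auto
  let ?f = "normal_density 0 (sqrt s)" and ?M = "density lborel (\<lambda>t. ennreal (normal_density 0 (sqrt s) t))"
  interpret prob_space ?M
    using s by (rule prob_space_normal_density)
  have "integrable lborel (\<lambda>t. ?f t * (t - 0)\<^sup>2)"
    using s by (rule integrable_normal_moment)
  then have int: "integrable ?M (\<lambda>t. t\<^sup>2)"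
    by (subst integrable_density) (auto simp: scaleR_conv_of_real)
  have "(LINT t|?M. t\<^sup>2) = (LINT t|lborel. ?f t * (t - 0) ^ (2 * 1))"
    by (subst integral_density) auto
  also have "\<dots> = s"
    unfolding integral_normal_moment_even[OF s] using ss by simp
  finally have var: "(LINT t|?M. t\<^sup>2) = s" .
  have "measure ?M {t. c < \<bar>t\<bar>} \<le> measure ?M {t \<in> space ?M. c\<^sup>2 \<le> t\<^sup>2}"
    using \<open>0 < c\<close> by (intro finite_measure_mono) (auto simp: abs_le_square_iff[symmetric])
  also have "\<dots> \<le> (LINT t|?M. t\<^sup>2) / c\<^sup>2"
    using int \<open>0 < c\<close> by (intro integral_Markov_inequality_measure[where A = "{}"]) auto
  finally show ?thesis
    using False by (simp add: var normal_law_def)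
qed

text \<open>As \<open>2 * pi \<ge> 4\<close>, the density is at most
  \<open>1 / (2 * sqrt s)\<close>, and the interval has length \<open>2 * c\<close>; the factors 2
  cancel.\<close>

lemma normal_law_small_ball:
  assumes "0 < s" "0 \<le> c"
  shows "measure (normal_law 0 s) {t. \<bar>t\<bar> \<le> c} \<le> c / sqrt s"
proof -
  let ?f = "normal_density 0 (sqrt s)"
  have le: "?f t \<le> 1 / (2 * sqrt s)" for t
  proof -
    have "sqrt 4 \<le> sqrt (2 * pi)"
      using pi_ge_two by (intro real_sqrt_le_mono) simp
    then have "2 * sqrt s \<le> sqrt (2 * pi * (sqrt s)\<^sup>2)"
      using assms by (simp add: real_sqrt_mult)
    then have "1 / sqrt (2 * pi * (sqrt s)\<^sup>2) \<le> 1 / (2 * sqrt s)"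
      using assms by (intro divide_left_mono) auto
    moreover have "exp (- (t - 0)\<^sup>2 / (2 * (sqrt s)\<^sup>2)) \<le> 1"
      using assms by simp
    ultimately have "?f t \<le> 1 / (2 * sqrt s) * 1"
      unfolding normal_density_def using assms by (intro mult_mono) auto
    then show ?thesis
      by simp
  qed
  have "{t. \<bar>t\<bar> \<le> c} = {- c..c}"
    by auto
  then have "emeasure (normal_law 0 s) {t. \<bar>t\<bar> \<le> c} = (\<integral>\<^sup>+ t. ennreal (?f t) * indicator {- c..c} t \<partial>lborel)"
    using assms by (simp add: normal_law_def emeasure_density)
  also have "\<dots> \<le> (\<integral>\<^sup>+ t. ennreal (1 / (2 * sqrt s)) * indicator {- c..c} t \<partial>lborel)"
    by (intro nn_integral_mono mult_right_mono ennreal_leI le) auto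
  also have "\<dots> = ennreal (1 / (2 * sqrt s)) * ennreal (2 * c)"
    using assms by (simp add: nn_integral_cmult)
  also have "\<dots> = ennreal (c / sqrt s)"
    using assms by (simp add: ennreal_mult'[symmetric])
  finally show ?thesis
    using assms by (simp add: measure_def enn2real_leI)
qed

lemma gaussian_vector_measure:
  assumes "gaussian_vector \<Omega> Z 0 C" and [measurable]: "S \<in> sets borel"
  shows "measure \<Omega> {\<omega> \<in> space \<Omega>. a \<bullet> Z \<omega> \<in> S} = measure (normal_law 0 (a \<bullet> (C *v a))) S"
proof -
  have [measurable]: "Z \<in> borel_measurable \<Omega>"
    using assms by (simp add: gaussian_vector_def)
  have "normal_law 0 (a \<bullet> (C *v a)) = distr \<Omega> borel (\<lambda>\<omega>. a \<bullet> Z \<omega>)"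
    using assms by (simp add: gaussian_vector_def)
  then show ?thesis
    by (simp add: measure_distr vimage_def Int_def conj_commute)
qed

lemma norm_matrix_entry_le: "\<bar>D $ i $ j\<bar> \<le> norm D" for D :: "real^'n^'m"
  by (rule order_trans[OF component_le_norm_cart Finite_Cartesian_Product.norm_nth_le])

lemma norm_add3_le: "norm (a + b + c) \<le> norm a + norm b + norm c"
  using norm_triangle_ineq[of "a + b" c] norm_triangle_ineq[of a b] by linarith

text \<open>The exceptional event collects a small critical coordinate \<open>g\<close> and a large
  coordinate of the remainder \<open>Z - g v\<close>. The scale \<open>t\<close> separating them is
  the fourth root of the variance of \<open>g\<close>: it diverges, yet is negligible against the
  standard deviation. The small ball costs \<open>1 / t\<close>, and the bounded transverse
  variances cost a multiple of \<open>1 / t^2\<close>. Off the event, the three contributions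
  \<open>v - vc\<close>, \<open>p / g\<close> and the remainder over \<open>g\<close> are each below
  \<open>\<eta> / 3\<close>.\<close>

lemma gaussian_direction:
  fixes C :: "'b \<Rightarrow> real^'n^'n" and v w p :: "'b \<Rightarrow> real^'n"
  defines "Q \<equiv> \<lambda>x. deflation_projection (v x) (w x)"
  assumes gauss: "\<forall>\<^sub>F x in F. gaussian_vector (\<Omega> x) (Z x) 0 (C x)"
    and v: "(v \<longlongrightarrow> vc) F"
    and p: "\<forall>\<^sub>F x in F. norm (p x) \<le> P"
    and var: "filterlim (\<lambda>x. w x \<bullet> (C x *v w x)) at_top F"
    and K: "\<forall>\<^sub>F x in F. norm (Q x ** C x ** transpose (Q x)) \<le> K"
    and "0 < \<eta>"
  obtains E where "\<forall>\<^sub>F x in F. E x \<in> sets (\<Omega> x)" "((\<lambda>x. measure (\<Omega> x) (E x)) \<longlongrightarrow> 0) F"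
    "\<forall>\<^sub>F x in F. \<forall>\<omega>\<in>space (\<Omega> x) - E x. R < \<bar>w x \<bullet> Z x \<omega>\<bar> \<and>
      norm ((p x + Z x \<omega>) /\<^sub>R (w x \<bullet> Z x \<omega>) - vc) < \<eta>"
proof -
  define s where "s x = w x \<bullet> (C x *v w x)" for x
  define t where "t x = sqrt (sqrt (s x))" for x
  let ?n = "real CARD('n)"
  \<comment> \<open>With every coordinate bounded by \<open>\<tau> x\<close>, the sum bound on the
    norm gives at most \<open>\<eta> * t x / 3\<close> for the remainder.\<close>
  define \<tau> where "\<tau> x = \<eta> * t x / (3 * ?n)" for x
  \<comment> \<open>This is row \<open>i\<close> of \<open>Q x\<close>: pairing with it reads off
    the \<open>i\<close>-th coordinate of the remainder, whose variance is therefore a diagonal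
    entry of the transverse covariance.\<close>
  define a where "a x i = transpose (Q x) *v axis i 1" for x i
  define E where "E x = {\<omega> \<in> space (\<Omega> x). w x \<bullet> Z x \<omega> \<in> {r. \<bar>r\<bar> \<le> t x}} \<union>
    (\<Union>i. {\<omega> \<in> space (\<Omega> x). a x i \<bullet> Z x \<omega> \<in> {r. \<tau> x < \<bar>r\<bar>}})" for x
  have s_lim: "filterlim s at_top F"
    using var by (simp add: s_def[abs_def])
  have t_lim: "filterlim t at_top F"
    unfolding t_def by (intro filterlim_compose[OF sqrt_at_top] s_lim)
  \<comment> \<open>Three demands at once: \<open>t x\<close> is positive, exceeds the requested
    \<open>R\<close>, and is large enough for the shift \<open>p x\<close> to drop below
    \<open>\<eta> / 3\<close> after division by \<open>g\<close>.\<close>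
  have t_pos: "\<forall>\<^sub>F x in F. max (max 0 R) (3 * P / \<eta>) < t x"
    using t_lim unfolding filterlim_at_top_dense by blast
  have E_sets: "\<forall>\<^sub>F x in F. E x \<in> sets (\<Omega> x)"
    using gauss
  proof eventually_elim
    case (elim x)
    then have [measurable]: "Z x \<in> borel_measurable (\<Omega> x)"
      by (simp add: gaussian_vector_def)
    show ?case
      unfolding E_def by measurable
  qed
  have a_inner: "a x i \<bullet> z = (z - (w x \<bullet> z) *\<^sub>R v x) $ i" for x i z
  proof -
    have "a x i \<bullet> z = axis i 1 \<bullet> (Q x *v z)"
      by (simp add: a_def dot_lmul_matrix)
    moreover have "outer_product (v x) (w x) *v z = (w x \<bullet> z) *\<^sub>R v x"
      by (simp add: outer_product_def matrix_vector_mult_def inner_vec_def vec_eq_iff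
          sum_distrib_left mult_ac)
    ultimately show ?thesis
      by (simp add: Q_def deflation_projection_def matrix_vector_mult_diff_rdistrib inner_axis')
  qed
  have a_var: "a x i \<bullet> (C x *v a x i) = (Q x ** C x ** transpose (Q x)) $ i $ i" for x i
  proof -
    have "a x i \<bullet> (C x *v a x i) = axis i 1 \<bullet> (Q x *v (C x *v a x i))"
      by (simp add: a_def dot_lmul_matrix)
    also have "\<dots> = ((Q x ** C x ** transpose (Q x)) *v axis i 1) $ i"
      by (simp add: a_def matrix_vector_mul_assoc matrix_mul_assoc inner_axis'
          del: transpose_matrix_vector)
    finally show ?thesis
      by (simp add: matrix_vector_mult_basis column_def)
  qed
  have "\<forall>\<^sub>F x in F. measure (\<Omega> x) (E x) \<le> 1 / t x + ?n * (9 * ?n\<^sup>2 * K / \<eta>\<^sup>2) / sqrt (s x)"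
    using gauss K t_pos E_sets
  proof eventually_elim
    case (elim x)
    then have t0: "0 < t x" and meas[measurable]: "Z x \<in> borel_measurable (\<Omega> x)"
      by (auto simp: gaussian_vector_def)
    interpret prob_space "\<Omega> x"
      using elim(1) by (simp add: gaussian_vector_def)
    have s0: "0 < s x" and tt: "(t x)\<^sup>2 = sqrt (s x)"
      using t0 by (auto simp: t_def)
    have "\<tau> x > 0"
      using t0 \<open>0 < \<eta>\<close> by (simp add: \<tau>_def)
    have 1: "measure (\<Omega> x) {\<omega> \<in> space (\<Omega> x). w x \<bullet> Z x \<omega> \<in> {r. \<bar>r\<bar> \<le> t x}} \<le> 1 / t x"
    proof -
      have "measure (\<Omega> x) {\<omega> \<in> space (\<Omega> x). w x \<bullet> Z x \<omega> \<in> {r. \<bar>r\<bar> \<le> t x}} \<le> t x / sqrt (s x)"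
        using normal_law_small_ball[OF s0, of "t x"] t0
        by (subst gaussian_vector_measure[OF elim(1)]) (auto simp: s_def)
      also have "\<dots> = 1 / t x"
        using t0 by (simp add: tt[symmetric] power2_eq_square)
      finally show ?thesis .
    qed
    have 2: "measure (\<Omega> x) {\<omega> \<in> space (\<Omega> x). a x i \<bullet> Z x \<omega> \<in> {r. \<tau> x < \<bar>r\<bar>}}
        \<le> (9 * ?n\<^sup>2 * K / \<eta>\<^sup>2) / sqrt (s x)" for i
    proof -
      have "0 \<le> a x i \<bullet> (C x *v a x i)"
        using elim(1) by (simp add: gaussian_vector_def)
      then have "measure (\<Omega> x) {\<omega> \<in> space (\<Omega> x). a x i \<bullet> Z x \<omega> \<in> {r. \<tau> x < \<bar>r\<bar>}}
          \<le> (a x i \<bullet> (C x *v a x i)) / (\<tau> x)\<^sup>2"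
        using normal_law_tail[OF _ \<open>\<tau> x > 0\<close>] by (subst gaussian_vector_measure[OF elim(1)]) auto
      also have "\<dots> \<le> K / (\<tau> x)\<^sup>2"
        using elim(2) norm_matrix_entry_le[of "Q x ** C x ** transpose (Q x)" i i]
        by (intro divide_right_mono) (auto simp: a_var)
      also have "\<dots> = (9 * ?n\<^sup>2 * K / \<eta>\<^sup>2) / sqrt (s x)"
        by (simp add: \<tau>_def tt[symmetric] power_divide power_mult_distrib)
      finally show ?thesis .
    qed
    have "measure (\<Omega> x) (E x) \<le> measure (\<Omega> x) {\<omega> \<in> space (\<Omega> x). w x \<bullet> Z x \<omega> \<in> {r. \<bar>r\<bar> \<le> t x}}
        + measure (\<Omega> x) (\<Union>i. {\<omega> \<in> space (\<Omega> x). a x i \<bullet> Z x \<omega> \<in> {r. \<tau> x < \<bar>r\<bar>}})"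
      unfolding E_def by (intro measure_Un_le) measurable
    also have "\<dots> \<le> 1 / t x +
        (\<Sum>i\<in>UNIV. measure (\<Omega> x) {\<omega> \<in> space (\<Omega> x). a x i \<bullet> Z x \<omega> \<in> {r. \<tau> x < \<bar>r\<bar>}})"
      by (intro add_mono 1 measure_UNION_le) auto
    also have "\<dots> \<le> 1 / t x + (\<Sum>i\<in>(UNIV::'n set). (9 * ?n\<^sup>2 * K / \<eta>\<^sup>2) / sqrt (s x))"
      by (intro add_left_mono sum_mono 2)
    finally show ?case
      by simp
  qed
  then have bound: "\<forall>\<^sub>F x in F. norm (measure (\<Omega> x) (E x))
      \<le> 1 / t x + ?n * (9 * ?n\<^sup>2 * K / \<eta>\<^sup>2) / sqrt (s x)"
    by simp
  have lim1: "((\<lambda>x. 1 / t x) \<longlongrightarrow> 0) F"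
    by (rule real_tendsto_divide_at_top[OF tendsto_const t_lim])
  have "filterlim (\<lambda>x. sqrt (s x)) at_top F"
    by (rule filterlim_compose[OF sqrt_at_top s_lim])
  then have lim2: "((\<lambda>x. ?n * (9 * ?n\<^sup>2 * K / \<eta>\<^sup>2) / sqrt (s x)) \<longlongrightarrow> 0) F"
    by (rule real_tendsto_divide_at_top[OF tendsto_const])
  have E_lim: "((\<lambda>x. measure (\<Omega> x) (E x)) \<longlongrightarrow> 0) F"
    using bound tendsto_add_zero[OF lim1 lim2] by (rule Lim_null_comparison)
  have "\<forall>\<^sub>F x in F. dist (v x) vc < \<eta> / 3"
    using \<open>0 < \<eta>\<close> by (intro tendstoD[OF v]) simp
  with p t_pos have "\<forall>\<^sub>F x in F. \<forall>\<omega>\<in>space (\<Omega> x) - E x. R < \<bar>w x \<bullet> Z x \<omega>\<bar> \<and>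
      norm ((p x + Z x \<omega>) /\<^sub>R (w x \<bullet> Z x \<omega>) - vc) < \<eta>"
  proof eventually_elim
    case (elim x)
    show ?case
    proof
      fix \<omega> assume \<omega>: "\<omega> \<in> space (\<Omega> x) - E x"
      define g where "g = w x \<bullet> Z x \<omega>"
      define r where "r = Z x \<omega> - g *\<^sub>R v x"
      have g: "t x < \<bar>g\<bar>"
        using \<omega> by (auto simp: E_def g_def not_le)
      then have g0: "0 < \<bar>g\<bar>"
        using elim(2) by linarith
      have ri: "\<bar>r $ i\<bar> \<le> \<tau> x" for i
        using \<omega> by (auto simp: E_def a_inner g_def r_def not_less)
      have "norm r \<le> (\<Sum>i\<in>UNIV. \<bar>r $ i\<bar>)"
        using norm_le_l1_cart by blast
      also have "\<dots> \<le> (\<Sum>i\<in>(UNIV::'n set). \<tau> x)"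
        by (intro sum_mono ri)
      finally have "norm r \<le> \<eta> * t x / 3"
        by (simp add: \<tau>_def)
      also have "\<dots> < \<eta> * \<bar>g\<bar> / 3"
        using g \<open>0 < \<eta>\<close> by simp
      finally have nr: "norm r / \<bar>g\<bar> < \<eta> / 3"
        using g0 by (simp add: divide_less_eq)
      have "3 * P / \<eta> < \<bar>g\<bar>"
        using elim(2) g by simp
      then have "norm (p x) < \<eta> / 3 * \<bar>g\<bar>"
        using elim(1) \<open>0 < \<eta>\<close> by (simp add: divide_less_eq mult.commute)
      then have np: "norm (p x) / \<bar>g\<bar> < \<eta> / 3"
        using g0 by (simp add: divide_less_eq)
      have split: "(p x + Z x \<omega>) /\<^sub>R g - vc = (v x - vc) + p x /\<^sub>R g + r /\<^sub>R g"
        using g0 by (simp add: r_def algebra_simps)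
      have "norm ((p x + Z x \<omega>) /\<^sub>R g - vc) \<le> norm (v x - vc) + norm (p x /\<^sub>R g) + norm (r /\<^sub>R g)"
        unfolding split by (rule norm_add3_le)
      also have "\<dots> < \<eta>"
      proof -
        have "norm (p x /\<^sub>R g) < \<eta> / 3" "norm (r /\<^sub>R g) < \<eta> / 3"
          using np nr by (simp_all only: norm_scaleR abs_inverse divide_inverse_commute)
        then show ?thesis
          using elim(3) unfolding dist_norm by linarith
      qed
      finally show "R < \<bar>w x \<bullet> Z x \<omega>\<bar> \<and> norm ((p x + Z x \<omega>) /\<^sub>R (w x \<bullet> Z x \<omega>) - vc) < \<eta>"
        using g elim(2) by (simp add: g_def)
    qed
  qed
  with E_sets E_lim show thesis
    by (rule that)
qed


section \<open>Spatial statistics\<close>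

lemma spatial_mean_scaleR: "spatial_mean (c *\<^sub>R u) = c * spatial_mean u"
  by (simp add: spatial_mean_def sum_distrib_left)

lemma central_moment_scaleR: "central_moment k (c *\<^sub>R u) = c ^ k * central_moment k u"
proof -
  have "(c * u $ i - c * spatial_mean u) ^ k = c ^ k * (u $ i - spatial_mean u) ^ k" for i
    by (simp add: power_mult_distrib flip: right_diff_distrib)
  then show ?thesis
    by (simp add: central_moment_def spatial_mean_scaleR sum_distrib_left)
qed

lemma central_moment_2_nonneg: "0 \<le> central_moment 2 u"
  by (simp add: central_moment_def sum_nonneg)

text \<open>The third moment scales with \<open>c ^ 3\<close> and the 3/2 power of the variance with
  \<open>\<bar>c\<bar> ^ 3\<close>, so only the sign of \<open>c\<close> is left.\<close>

lemma skewness_scaleR: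
  assumes "c \<noteq> 0"
  shows "skewness (c *\<^sub>R u) = sgn c * skewness u"
proof -
  have "c\<^sup>2 = \<bar>c\<bar> powr 2"
    using assms by simp
  then have "(c\<^sup>2) powr (3 / 2) = \<bar>c\<bar> ^ 3"
    using assms by (simp only: powr_powr) simp
  moreover have "c ^ 3 = sgn c * \<bar>c\<bar> ^ 3"
    by (simp add: sgn_if abs_if power3_eq_cube)
  ultimately show ?thesis
    using assms central_moment_2_nonneg[of u]
    by (simp add: skewness_def central_moment_scaleR powr_mult)
qed

lemma kurtosis_scaleR: "c \<noteq> 0 \<Longrightarrow> kurtosis (c *\<^sub>R u) = kurtosis u"
  by (simp add: kurtosis_def central_moment_scaleR power_mult_distrib flip: power_mult)

lemma moran_I_scaleR:
  assumes "c \<noteq> 0"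
  shows "moran_I A (c *\<^sub>R u) = moran_I A u"
proof -
  have 1: "(\<Sum>i\<in>UNIV. \<Sum>j\<in>UNIV. A $ i $ j * (c * u $ i - c * spatial_mean u) * (c * u $ j - c * spatial_mean u))
      = c\<^sup>2 * (\<Sum>i\<in>UNIV. \<Sum>j\<in>UNIV. A $ i $ j * (u $ i - spatial_mean u) * (u $ j - spatial_mean u))"
    unfolding sum_distrib_left by (intro sum.cong refl) (simp add: power2_eq_square algebra_simps)
  have 2: "(\<Sum>i\<in>UNIV. (c * u $ i - c * spatial_mean u)\<^sup>2) = c\<^sup>2 * (\<Sum>i\<in>UNIV. (u $ i - spatial_mean u)\<^sup>2)"
    unfolding sum_distrib_left by (intro sum.cong refl) (simp add: power2_eq_square algebra_simps)
  show ?thesis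
    using assms by (simp add: moran_I_def spatial_mean_scaleR 1 2)
qed

section \<open>Continuity and measurability of the statistics\<close>

lemma continuous_on_spatial_mean [continuous_intros]:
  "continuous_on S f \<Longrightarrow> continuous_on S (\<lambda>x. spatial_mean (f x))"
  unfolding spatial_mean_def by (intro continuous_intros) auto

lemma continuous_on_central_moment [continuous_intros]:
  "continuous_on S f \<Longrightarrow> continuous_on S (\<lambda>x. central_moment k (f x))"
  unfolding central_moment_def by (intro continuous_intros) auto

lemma sum_squared_deviations: "(\<Sum>i\<in>UNIV. (u $ i - spatial_mean u)\<^sup>2) = real CARD('n) * central_moment 2 u"
  for u :: "real^'n"
  by (simp add: central_moment_def)

text \<open>Positive variance keeps the denominator off zero and the base of \<open>powr\<close>
  positive.\<close>

lemma isCont_skewness: "0 < central_moment 2 u \<Longrightarrow> isCont skewness u"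
  unfolding skewness_def[abs_def]
  using continuous_on_central_moment[OF continuous_on_id, of UNIV]
  by (intro continuous_intros) (auto simp: continuous_on_eq_continuous_at)

lemma isCont_kurtosis: "0 < central_moment 2 u \<Longrightarrow> isCont kurtosis u"
  unfolding kurtosis_def[abs_def]
  using continuous_on_central_moment[OF continuous_on_id, of UNIV]
  by (intro continuous_intros) (auto simp: continuous_on_eq_continuous_at)

lemma isCont_moran_I: "0 < central_moment 2 u \<Longrightarrow> isCont (moran_I A) u"
  unfolding moran_I_def[abs_def] sum_squared_deviations
  using continuous_on_central_moment[OF continuous_on_id, of UNIV]
    continuous_on_spatial_mean[OF continuous_on_id, of UNIV]
  by (intro continuous_intros) (auto simp: continuous_on_eq_continuous_at)

lemma borel_measurable_spatial_mean [measurable]: "spatial_mean \<in> borel_measurable borel"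
  by (intro borel_measurable_continuous_onI continuous_on_spatial_mean continuous_on_id)

lemma borel_measurable_central_moment [measurable]: "central_moment k \<in> borel_measurable borel"
  by (intro borel_measurable_continuous_onI continuous_on_central_moment continuous_on_id)

lemma borel_measurable_skewness [measurable]: "skewness \<in> borel_measurable borel"
  unfolding skewness_def[abs_def] by measurable

lemma borel_measurable_kurtosis [measurable]: "kurtosis \<in> borel_measurable borel"
  unfolding kurtosis_def[abs_def] by measurable

lemma borel_measurable_moran_I [measurable]:
  fixes A :: "real^'n^'n"
  shows "moran_I A \<in> borel_measurable borel"
proof -
  have [measurable]: "(\<lambda>u. u $ i - spatial_mean u) \<in> borel_measurable borel" for i :: 'n
    by (intro borel_measurable_continuous_onI continuous_intros)
  then show ?thesis
    unfolding moran_I_def[abs_def] by measurable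
qed

text \<open>For a unit vector the squared deviations sum to 1 minus the quotient in the second
  assumption. This is where \<rho>_c < 1 enters.\<close>

lemma central_moment_2_pos:
  fixes u :: "real^'n"
  assumes "norm u = 1" "(\<Sum>i\<in>UNIV. u $ i)\<^sup>2 / real CARD('n) < 1"
  shows "0 < central_moment 2 u"
proof -
  let ?n = "real CARD('n)" and ?m = "spatial_mean u"
  have S: "(\<Sum>i\<in>UNIV. u $ i) = ?n * ?m"
    by (simp add: spatial_mean_def)
  have "(\<Sum>i\<in>UNIV. (u $ i)\<^sup>2) = 1"
    using assms(1) by (simp add: norm_eq_1 inner_vec_def power2_eq_square)
  then have "(\<Sum>i\<in>UNIV. (u $ i - ?m)\<^sup>2) = 1 - 2 * ?m * (\<Sum>i\<in>UNIV. u $ i) + ?n * ?m\<^sup>2"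
    by (simp add: power2_diff sum.distrib sum_subtractf sum_distrib_left sum_distrib_right mult_ac)
  also have "\<dots> = 1 - ?n * ?m\<^sup>2"
    by (simp add: S power2_eq_square)
  also have "\<dots> > 0"
    using assms(2) by (simp add: S power2_eq_square mult_ac)
  finally show ?thesis
    by (simp add: central_moment_def)
qed

lemma centering_mult_vec: "(centering *v u) $ i = u $ i - spatial_mean u"
  by (simp add: centering_def matrix_vector_mult_diff_rdistrib)
    (simp add: matrix_vector_mult_def spatial_mean_def sum_divide_distrib)

lemma transpose_centering: "transpose centering = centering"
  by (auto simp: centering_def transpose_def mat_def vec_eq_iff)

text \<open>Centering is symmetric, so in the numerator it moves onto both arguments. In the
  denominator one factor is enough because the deviations sum to zero.\<close>

lemma moran_I_quadratic_form:
  fixes u :: "real^'n"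
  shows "moran_I A u = real CARD('n) / total_weight A *
    ((u \<bullet> ((centering ** A ** centering) *v u)) / (u \<bullet> (centering *v u)))"
proof -
  let ?c = "centering *v u"
  have "u \<bullet> ((centering ** A ** centering) *v u) = ?c \<bullet> (A *v ?c)"
    using transpose_matrix_vector[of centering u]
    by (simp add: transpose_centering dot_lmul_matrix[of u centering, symmetric]
        flip: matrix_vector_mul_assoc)
  also have "\<dots> = (\<Sum>i\<in>UNIV. \<Sum>j\<in>UNIV. A $ i $ j * (u $ i - spatial_mean u) * (u $ j - spatial_mean u))"
    by (simp add: inner_vec_def matrix_vector_mult_def[of A] centering_mult_vec sum_distrib_left mult_ac)
  finally have 1: "u \<bullet> ((centering ** A ** centering) *v u) = \<dots>" .
  have "(\<Sum>i\<in>UNIV. u $ i - spatial_mean u) = 0"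
    by (simp add: sum_subtractf spatial_mean_def)
  then have "(\<Sum>i\<in>UNIV. spatial_mean u * (u $ i - spatial_mean u)) = 0"
    by (simp flip: sum_distrib_left)
  moreover have "(\<Sum>i\<in>UNIV. (u $ i - spatial_mean u)\<^sup>2)
      = u \<bullet> ?c - (\<Sum>i\<in>UNIV. spatial_mean u * (u $ i - spatial_mean u))"
    by (simp add: inner_vec_def centering_mult_vec power2_eq_square left_diff_distrib
        flip: sum_subtractf)
  ultimately show ?thesis
    by (simp add: moran_I_def 1)
qed

section \<open>Convergence in probability of statistics of the Gaussian vector\<close>

lemma tendsto_in_probI:
  assumes "\<forall>\<^sub>F x in F. prob_space (\<Omega> x)" "\<forall>\<^sub>F x in F. X x \<in> borel_measurable (\<Omega> x)"
    and "\<And>\<epsilon>. 0 < \<epsilon> \<Longrightarrow> \<exists>E. (\<forall>\<^sub>F x in F. E x \<in> sets (\<Omega> x)) \<and>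
      ((\<lambda>x. measure (\<Omega> x) (E x)) \<longlongrightarrow> 0) F \<and>
      (\<forall>\<^sub>F x in F. \<forall>\<omega>\<in>space (\<Omega> x) - E x. \<bar>X x \<omega> - l\<bar> \<le> \<epsilon>)"
  shows "tendsto_in_prob \<Omega> X l F"
  unfolding tendsto_in_prob_def
proof (intro conjI allI impI assms(2))
  fix \<epsilon> :: real assume "0 < \<epsilon>"
  from assms(3)[OF this] obtain E where E: "\<forall>\<^sub>F x in F. E x \<in> sets (\<Omega> x)"
    "((\<lambda>x. measure (\<Omega> x) (E x)) \<longlongrightarrow> 0) F"
    "\<forall>\<^sub>F x in F. \<forall>\<omega>\<in>space (\<Omega> x) - E x. \<bar>X x \<omega> - l\<bar> \<le> \<epsilon>"
    by blast
  \<comment> \<open>The deviation event lies inside the measurable exceptional event, so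
    monotonicity dominates its probability.\<close>
  have "\<forall>\<^sub>F x in F. measure (\<Omega> x) {\<omega> \<in> space (\<Omega> x). \<epsilon> < \<bar>X x \<omega> - l\<bar>} \<le> measure (\<Omega> x) (E x)"
    using assms(1) E(1,3)
  proof eventually_elim
    case (elim x)
    then interpret prob_space "\<Omega> x" by simp
    show ?case
      by (rule finite_measure_mono) (use elim in \<open>auto simp: not_less[symmetric]\<close>)
  qed
  then have "\<forall>\<^sub>F x in F. norm (measure (\<Omega> x) {\<omega> \<in> space (\<Omega> x). \<epsilon> < \<bar>X x \<omega> - l\<bar>}) \<le> measure (\<Omega> x) (E x)"
    by simp
  then show "((\<lambda>x. measure (\<Omega> x) {\<omega> \<in> space (\<Omega> x). \<epsilon> < \<bar>X x \<omega> - l\<bar>}) \<longlongrightarrow> 0) F"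
    using E(2) by (rule Lim_null_comparison)
qed


lemma tendsto_in_prob_diff_const:
  assumes "tendsto_in_prob \<Omega> (\<lambda>x \<omega>. X x \<omega> - l) 0 F"
  shows "tendsto_in_prob \<Omega> X l F"
proof -
  have "X x \<in> borel_measurable (\<Omega> x)" if "(\<lambda>\<omega>. X x \<omega> - l) \<in> borel_measurable (\<Omega> x)" for x
    using borel_measurable_add[OF that borel_measurable_const[of l]] by simp
  moreover have "\<forall>\<^sub>F x in F. (\<lambda>\<omega>. X x \<omega> - l) \<in> borel_measurable (\<Omega> x)"
    using assms by (simp add: tendsto_in_prob_def)
  ultimately have "\<forall>\<^sub>F x in F. X x \<in> borel_measurable (\<Omega> x)"
    by (rule eventually_mono[rotated])
  then show ?thesis
    using assms by (simp add: tendsto_in_prob_def)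
qed

text \<open>One argument serves all three statistics: dividing by the critical coordinate
  \<open>g\<close> costs the factor \<open>\<sigma> g\<close>, a sign for the skewness and
  \<open>1\<close> for the two even statistics. The shifts \<open>p\<close> and \<open>m\<close> are
  kept apart because \<gamma> is formed from \<open>x\<close> even when the statistic is taken of
  \<open>y\<close>.\<close>

lemma gaussian_statistic_in_prob:
  fixes C :: "'b \<Rightarrow> real^'n^'n" and v w p m :: "'b \<Rightarrow> real^'n" and f :: "real^'n \<Rightarrow> real"
  defines "Q \<equiv> \<lambda>x. deflation_projection (v x) (w x)"
  assumes gauss: "\<forall>\<^sub>F x in F. gaussian_vector (\<Omega> x) (Z x) 0 (C x)"
    and v: "(v \<longlongrightarrow> vc) F" and w: "(w \<longlongrightarrow> wc) F"
    and p: "(p \<longlongrightarrow> pc) F" and m: "(m \<longlongrightarrow> mc) F"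
    and var: "filterlim (\<lambda>x. w x \<bullet> (C x *v w x)) at_top F"
    and K: "\<forall>\<^sub>F x in F. norm (Q x ** C x ** transpose (Q x)) \<le> K"
    and f: "isCont f vc" and [measurable]: "f \<in> borel_measurable borel"
    and \<sigma>: "\<sigma> = sgn \<or> \<sigma> = (\<lambda>_. 1)"
    and scale: "\<And>c u. c \<noteq> 0 \<Longrightarrow> f (c *\<^sub>R u) = \<sigma> c * f u"
  shows "tendsto_in_prob \<Omega> (\<lambda>x \<omega>. f (p x + Z x \<omega>) - \<sigma> (w x \<bullet> (m x + Z x \<omega>)) * f vc) 0 F"
proof (rule tendsto_in_probI)
  show "\<forall>\<^sub>F x in F. prob_space (\<Omega> x)"
    using gauss by eventually_elim (simp add: gaussian_vector_def)
  have [measurable]: "\<sigma> \<in> borel_measurable borel"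
    using \<sigma> by auto
  show "\<forall>\<^sub>F x in F. (\<lambda>\<omega>. f (p x + Z x \<omega>) - \<sigma> (w x \<bullet> (m x + Z x \<omega>)) * f vc) \<in> borel_measurable (\<Omega> x)"
    using gauss
  proof eventually_elim
    case (elim x)
    then have [measurable]: "Z x \<in> borel_measurable (\<Omega> x)"
      by (simp add: gaussian_vector_def)
    show ?case
      by measurable
  qed
  fix \<epsilon> :: real assume "0 < \<epsilon>"
  then obtain \<eta> where "0 < \<eta>" and \<eta>: "\<And>u. norm (u - vc) < \<eta> \<Longrightarrow> \<bar>f u - f vc\<bar> < \<epsilon>"
    using f by (auto simp: continuous_at_eps_delta dist_norm)
  have "\<forall>\<^sub>F x in F. norm (p x) < norm pc + 1"
    by (intro order_tendstoD(2)[OF tendsto_norm[OF p]]) simp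
  then have p_le: "\<forall>\<^sub>F x in F. norm (p x) \<le> norm pc + 1"
    by eventually_elim simp
  have wm: "\<forall>\<^sub>F x in F. \<bar>w x \<bullet> m x\<bar> < \<bar>wc \<bullet> mc\<bar> + 1"
    by (intro order_tendstoD(2)[OF tendsto_rabs[OF tendsto_inner[OF w m]]]) simp
  \<comment> \<open>The lower bound requested for the critical coordinate is the eventual bound on
    \<open>w x \<bullet> m x\<close> from \<open>wm\<close>, so the deterministic part cannot flip
    the sign.\<close>
  obtain E where E: "\<forall>\<^sub>F x in F. E x \<in> sets (\<Omega> x)" "((\<lambda>x. measure (\<Omega> x) (E x)) \<longlongrightarrow> 0) F"
    "\<forall>\<^sub>F x in F. \<forall>\<omega>\<in>space (\<Omega> x) - E x. \<bar>wc \<bullet> mc\<bar> + 1 < \<bar>w x \<bullet> Z x \<omega>\<bar> \<and>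
      norm ((p x + Z x \<omega>) /\<^sub>R (w x \<bullet> Z x \<omega>) - vc) < \<eta>"
    by (rule gaussian_direction[OF gauss v p_le var K[unfolded Q_def] \<open>0 < \<eta>\<close>])
  have "\<forall>\<^sub>F x in F. \<forall>\<omega>\<in>space (\<Omega> x) - E x.
      \<bar>f (p x + Z x \<omega>) - \<sigma> (w x \<bullet> (m x + Z x \<omega>)) * f vc - 0\<bar> \<le> \<epsilon>"
    using E(3) wm
  proof eventually_elim
    case (elim x)
    show ?case
    proof
      fix \<omega> assume \<omega>: "\<omega> \<in> space (\<Omega> x) - E x"
      define g where "g = w x \<bullet> Z x \<omega>"
      let ?u = "(p x + Z x \<omega>) /\<^sub>R g"
      have g: "\<bar>w x \<bullet> m x\<bar> < \<bar>g\<bar>" and u: "norm (?u - vc) < \<eta>"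
        using bspec[OF elim(1) \<omega>] elim(2) unfolding g_def by auto
      then have "g \<noteq> 0"
        by auto
      have "sgn (w x \<bullet> m x + g) = sgn g"
        using g by (auto simp: sgn_if abs_if split: if_splits)
      then have "\<sigma> (w x \<bullet> (m x + Z x \<omega>)) = \<sigma> g"
        using \<sigma> by (auto simp: inner_add_right g_def)
      moreover have "f (p x + Z x \<omega>) = \<sigma> g * f ?u"
        using scale[OF \<open>g \<noteq> 0\<close>, of ?u] \<open>g \<noteq> 0\<close> by simp
      moreover have "\<bar>\<sigma> g\<bar> \<le> 1"
        using \<sigma> by (auto simp: sgn_if)
      then have "\<bar>\<sigma> g * (f ?u - f vc)\<bar> \<le> 1 * \<epsilon>"
        unfolding abs_mult using \<eta>[OF u] by (intro mult_mono) auto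
      ultimately show "\<bar>f (p x + Z x \<omega>) - \<sigma> (w x \<bullet> (m x + Z x \<omega>)) * f vc - 0\<bar> \<le> \<epsilon>"
        by (simp add: right_diff_distrib)
    qed
  qed
  then show "\<exists>E. (\<forall>\<^sub>F x in F. E x \<in> sets (\<Omega> x)) \<and> ((\<lambda>x. measure (\<Omega> x) (E x)) \<longlongrightarrow> 0) F \<and>
      (\<forall>\<^sub>F x in F. \<forall>\<omega>\<in>space (\<Omega> x) - E x.
        \<bar>f (p x + Z x \<omega>) - \<sigma> (w x \<bullet> (m x + Z x \<omega>)) * f vc - 0\<bar> \<le> \<epsilon>)"
    using E(1,2) by (intro exI[of _ E] conjI)
qed

theorem corollary7p3:
  fixes F :: "real^'n \<Rightarrow> real \<Rightarrow> real^'n"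
    and B :: "real^'m^'n"
    and A :: "real^'n^'n"
    and xs :: "real \<Rightarrow> real^'n" and xc :: "real^'n"
    and \<alpha>0 \<alpha>c :: real
    and U :: "((real^'n) \<times> real) set"
    and M C :: "real \<Rightarrow> real^'n^'n"
    and lam :: "real \<Rightarrow> real" and \<delta> :: real
    and v w :: "real \<Rightarrow> real^'n" and vc wc :: "real^'n"
    and \<Omega> :: "real \<Rightarrow> 'a measure"
    and z x y :: "real \<Rightarrow> 'a \<Rightarrow> real^'n"
    and \<gamma> :: "real \<Rightarrow> 'a \<Rightarrow> real"
    and b :: "real^'n"
  assumes N_ge_2: "CARD('n) \<ge> 2"
    \<comment> \<open>equilibrium branch\<close>
    and interval: "\<alpha>0 < \<alpha>c"
    and smooth: "C2_on (\<lambda>(p, \<alpha>). F p \<alpha>) U"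
    and branch_in_U: "\<And>\<alpha>. \<alpha>0 < \<alpha> \<Longrightarrow> \<alpha> < \<alpha>c \<Longrightarrow> (xs \<alpha>, \<alpha>) \<in> U"
    and endpoint_in_U: "(xc, \<alpha>c) \<in> U"
    and equilibrium: "\<And>\<alpha>. \<alpha>0 < \<alpha> \<Longrightarrow> \<alpha> < \<alpha>c \<Longrightarrow> F (xs \<alpha>) \<alpha> = 0"
    and stable: "\<And>\<alpha>. \<alpha>0 < \<alpha> \<Longrightarrow> \<alpha> < \<alpha>c \<Longrightarrow> asymptotically_stable (\<lambda>p. F p \<alpha>) (xs \<alpha>)"
    and M_eq: "\<And>\<alpha>. \<alpha>0 < \<alpha> \<Longrightarrow> \<alpha> < \<alpha>c \<Longrightarrow> M \<alpha> = - jacobian (\<lambda>p. F p \<alpha>) (at (xs \<alpha>))"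
    and C_cov: "\<forall>\<^sub>F \<alpha> in at_left \<alpha>c. stationary_covariance (M \<alpha>) B (C \<alpha>)"
    \<comment> \<open>regular simple real critical eigenvalue\<close>
    and xs_lim: "(xs \<longlongrightarrow> xc) (at_left \<alpha>c)"
    and M_diag: "\<forall>\<^sub>F \<alpha> in at_left \<alpha>c. diagonalizable (complex_matrix (M \<alpha>))"
    and eig_pos: "\<forall>\<^sub>F \<alpha> in at_left \<alpha>c. \<forall>\<mu>. eigenvalue (complex_matrix (M \<alpha>)) \<mu> \<longrightarrow> Re \<mu> > 0"
    and crit_simple: "\<forall>\<^sub>F \<alpha> in at_left \<alpha>c.
          simple_eigenvalue (complex_matrix (M \<alpha>)) (complex_of_real (lam \<alpha>))"
    and crit_smallest: "\<forall>\<^sub>F \<alpha> in at_left \<alpha>c.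
          \<forall>\<mu>. eigenvalue (complex_matrix (M \<alpha>)) \<mu> \<longrightarrow> lam \<alpha> \<le> Re \<mu>"
    and crit_pos: "\<forall>\<^sub>F \<alpha> in at_left \<alpha>c. lam \<alpha> > 0"
    and crit_lim: "(lam \<longlongrightarrow> 0) (at_left \<alpha>c)"
    and gap_pos: "\<delta> > 0"
    and gap: "\<forall>\<^sub>F \<alpha> in at_left \<alpha>c. \<forall>\<mu>. eigenvalue (complex_matrix (M \<alpha>)) \<mu> \<and>
          \<mu> \<noteq> complex_of_real (lam \<alpha>) \<longrightarrow> Re \<mu> \<ge> \<delta>"
    and v_eig: "\<forall>\<^sub>F \<alpha> in at_left \<alpha>c. M \<alpha> *v v \<alpha> = lam \<alpha> *\<^sub>R v \<alpha>"
    and w_eig: "\<forall>\<^sub>F \<alpha> in at_left \<alpha>c. w \<alpha> v* M \<alpha> = lam \<alpha> *\<^sub>R w \<alpha>"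
    and v_norm: "\<forall>\<^sub>F \<alpha> in at_left \<alpha>c. norm (v \<alpha>) = 1"
    and wv_norm: "\<forall>\<^sub>F \<alpha> in at_left \<alpha>c. w \<alpha> \<bullet> v \<alpha> = 1"
    and v_lim: "(v \<longlongrightarrow> vc) (at_left \<alpha>c)"
    and w_lim: "(w \<longlongrightarrow> wc) (at_left \<alpha>c)"
    \<comment> \<open>hypotheses of the corollary\<close>
    and weight_pos: "total_weight A > 0"
    and sigma_eff_pos: "wc \<bullet> ((B ** transpose B) *v wc) > 0"
    and rho_less_1: "(\<Sum>i\<in>UNIV. vc $ i)\<^sup>2 / real CARD('n) < 1"
    and z_law: "\<forall>\<^sub>F \<alpha> in at_left \<alpha>c. gaussian_vector (\<Omega> \<alpha>) (z \<alpha>) 0 (C \<alpha>)"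
    and x_eq: "\<And>\<alpha> \<omega>. x \<alpha> \<omega> = xs \<alpha> + z \<alpha> \<omega>"
    and \<gamma>_eq: "\<And>\<alpha> \<omega>. \<gamma> \<alpha> \<omega> = w \<alpha> \<bullet> x \<alpha> \<omega>"
    and y_eq: "\<And>\<alpha> \<omega>. y \<alpha> \<omega> = x \<alpha> \<omega> - b"
  shows "\<forall>u\<in>{x, y}.
      tendsto_in_prob \<Omega>
        (\<lambda>\<alpha> \<omega>. skewness (u \<alpha> \<omega>)
           - sgn (\<gamma> \<alpha> \<omega>) * (central_moment 3 vc / central_moment 2 vc powr (3 / 2)))
        0 (at_left \<alpha>c) \<and>
      tendsto_in_prob \<Omega> (\<lambda>\<alpha> \<omega>. kurtosis (u \<alpha> \<omega>))
        (central_moment 4 vc / (central_moment 2 vc)\<^sup>2) (at_left \<alpha>c) \<and>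
      tendsto_in_prob \<Omega> (\<lambda>\<alpha> \<omega>. moran_I A (u \<alpha> \<omega>))
        (real CARD('n) / total_weight A *
           ((vc \<bullet> ((centering ** A ** centering) *v vc)) / (vc \<bullet> (centering *v vc))))
        (at_left \<alpha>c)"
proof -
  let ?F = "at_left \<alpha>c" and ?G = "B ** transpose B"
  have nt: "?F \<noteq> bot"
    by simp
  have near: "\<forall>\<^sub>F \<alpha> in ?F. \<alpha>0 < \<alpha> \<and> \<alpha> < \<alpha>c"
    using eventually_at_left_real[OF interval] by eventually_elim simp
  then have "\<forall>\<^sub>F \<alpha> in ?F. (xs \<alpha>, \<alpha>) \<in> U"
    by eventually_elim (use branch_in_U in blast)
  then obtain J where J: "((\<lambda>\<alpha>. jacobian (\<lambda>p. F p \<alpha>) (at (xs \<alpha>))) \<longlongrightarrow> J) ?F"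
    using tendsto_jacobian[OF smooth endpoint_in_U xs_lim] by blast
  have "\<forall>\<^sub>F \<alpha> in ?F. - jacobian (\<lambda>p. F p \<alpha>) (at (xs \<alpha>)) = M \<alpha>"
    using near by eventually_elim (simp add: M_eq)
  with tendsto_minus[OF J] have M_lim: "(M \<longlongrightarrow> - J) ?F"
    by (rule Lim_transform_eventually)
  obtain K where K: "\<forall>\<^sub>F \<alpha> in ?F. norm (deflation_projection (v \<alpha>) (w \<alpha>) ** C \<alpha> **
      transpose (deflation_projection (v \<alpha>) (w \<alpha>))) \<le> K"
    by (rule transverse_covariance_bounded[OF nt gap_pos M_lim v_lim w_lim C_cov M_diag crit_simple
          gap crit_pos v_eig w_eig wv_norm])
  have "((\<lambda>\<alpha>. ?G *v w \<alpha>) \<longlongrightarrow> ?G *v wc) ?F"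
    by (rule bounded_linear.tendsto[OF matrix_vector_mul_bounded_linear w_lim])
  then have num: "((\<lambda>\<alpha>. w \<alpha> \<bullet> (?G *v w \<alpha>)) \<longlongrightarrow> wc \<bullet> (?G *v wc)) ?F"
    by (rule tendsto_inner[OF w_lim])
  have "((\<lambda>\<alpha>. 2 * lam \<alpha>) \<longlongrightarrow> 0) ?F"
    using tendsto_mult_right_zero[OF crit_lim] .
  \<comment> \<open>Positivity of \<open>lam\<close> makes this limit one-sided, so the inverse
    tends to plus infinity.\<close>
  then have "filterlim (\<lambda>\<alpha>. inverse (2 * lam \<alpha>)) at_top ?F"
    by (rule filterlim_inverse_at_top) (use crit_pos in simp)
  then have "filterlim (\<lambda>\<alpha>. (w \<alpha> \<bullet> (?G *v w \<alpha>)) * inverse (2 * lam \<alpha>)) at_top ?F"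
    by (rule filterlim_tendsto_pos_mult_at_top[OF num sigma_eff_pos])
  moreover
  have "\<forall>\<^sub>F \<alpha> in ?F. (w \<alpha> \<bullet> (?G *v w \<alpha>)) * inverse (2 * lam \<alpha>) = w \<alpha> \<bullet> (C \<alpha> *v w \<alpha>)"
    using C_cov w_eig crit_pos
  proof eventually_elim
    case (elim \<alpha>)
    then show ?case
      by (simp only: critical_variance[OF elim] divide_inverse)
  qed
  then have "filterlim (\<lambda>\<alpha>. (w \<alpha> \<bullet> (?G *v w \<alpha>)) * inverse (2 * lam \<alpha>)) at_top ?F
      \<longleftrightarrow> filterlim (\<lambda>\<alpha>. w \<alpha> \<bullet> (C \<alpha> *v w \<alpha>)) at_top ?F"
    by (rule filterlim_cong[OF refl refl])
  ultimately have var: "filterlim (\<lambda>\<alpha>. w \<alpha> \<bullet> (C \<alpha> *v w \<alpha>)) at_top ?F"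
    by (rule iffD1[rotated])
  have "\<forall>\<^sub>F \<alpha> in ?F. norm (v \<alpha>) = 1"
    by (rule v_norm)
  then have "((\<lambda>\<alpha>. norm (v \<alpha>)) \<longlongrightarrow> 1) ?F"
    by (rule tendsto_eventually)
  then have "norm vc = 1"
    using tendsto_unique[OF nt tendsto_norm[OF v_lim]] by blast
  then have vc: "0 < central_moment 2 vc"
    using rho_less_1 by (rule central_moment_2_pos)
  \<comment> \<open>The parameter \<open>q\<close> treats both cases together: \<open>0\<close>
    gives \<open>x\<close> and \<open>b\<close> gives \<open>y\<close>, with the same
    \<gamma>.\<close>
  have *: "tendsto_in_prob \<Omega> (\<lambda>\<alpha> \<omega>. skewness (u \<alpha> \<omega>) - sgn (\<gamma> \<alpha> \<omega>) * skewness vc) 0 ?F \<and>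
      tendsto_in_prob \<Omega> (\<lambda>\<alpha> \<omega>. kurtosis (u \<alpha> \<omega>)) (kurtosis vc) ?F \<and>
      tendsto_in_prob \<Omega> (\<lambda>\<alpha> \<omega>. moran_I A (u \<alpha> \<omega>)) (moran_I A vc) ?F"
    if u: "u = (\<lambda>\<alpha> \<omega>. (xs \<alpha> - q) + z \<alpha> \<omega>)" for u q
  proof -
    have p: "((\<lambda>\<alpha>. xs \<alpha> - q) \<longlongrightarrow> xc - q) ?F"
      by (intro tendsto_diff xs_lim tendsto_const)
    note stat = gaussian_statistic_in_prob[OF z_law v_lim w_lim p xs_lim var K]
    have "tendsto_in_prob \<Omega> (\<lambda>\<alpha> \<omega>. skewness (u \<alpha> \<omega>) - sgn (\<gamma> \<alpha> \<omega>) * skewness vc) 0 ?F"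
      unfolding u \<gamma>_eq x_eq
      by (rule stat[OF isCont_skewness[OF vc] borel_measurable_skewness _ skewness_scaleR]) simp_all
    \<comment> \<open>The factor \<open>1\<close> is the value of \<open>\<sigma>\<close> for an
      even statistic; it brings the claim into the common form.\<close>
    moreover have "tendsto_in_prob \<Omega> (\<lambda>\<alpha> \<omega>. kurtosis (u \<alpha> \<omega>) - 1 * kurtosis vc) 0 ?F"
      unfolding u
      by (rule stat[OF isCont_kurtosis[OF vc] borel_measurable_kurtosis, where \<sigma> = "\<lambda>_. 1"])
        (simp_all add: kurtosis_scaleR)
    moreover have "tendsto_in_prob \<Omega> (\<lambda>\<alpha> \<omega>. moran_I A (u \<alpha> \<omega>) - 1 * moran_I A vc) 0 ?F"
      unfolding u
      by (rule stat[OF isCont_moran_I[OF vc] borel_measurable_moran_I, where \<sigma> = "\<lambda>_. 1"])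
        (simp_all add: moran_I_scaleR)
    ultimately show ?thesis
      by (simp add: tendsto_in_prob_diff_const)
  qed
  show ?thesis
  proof
    fix u assume "u \<in> {x, y}"
    then have "u = (\<lambda>\<alpha> \<omega>. (xs \<alpha> - 0) + z \<alpha> \<omega>) \<or> u = (\<lambda>\<alpha> \<omega>. (xs \<alpha> - b) + z \<alpha> \<omega>)"
      by (auto simp: fun_eq_iff x_eq y_eq)
    then obtain q where "u = (\<lambda>\<alpha> \<omega>. (xs \<alpha> - q) + z \<alpha> \<omega>)"
      by (elim disjE)
    from *[OF this] show "tendsto_in_prob \<Omega> (\<lambda>\<alpha> \<omega>. skewness (u \<alpha> \<omega>) - sgn (\<gamma> \<alpha> \<omega>) *
          (central_moment 3 vc / central_moment 2 vc powr (3 / 2))) 0 ?F \<and>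
        tendsto_in_prob \<Omega> (\<lambda>\<alpha> \<omega>. kurtosis (u \<alpha> \<omega>))
          (central_moment 4 vc / (central_moment 2 vc)\<^sup>2) ?F \<and>
        tendsto_in_prob \<Omega> (\<lambda>\<alpha> \<omega>. moran_I A (u \<alpha> \<omega>)) (real CARD('n) / total_weight A *
          ((vc \<bullet> ((centering ** A ** centering) *v vc)) / (vc \<bullet> (centering *v vc)))) ?F"
      unfolding skewness_def[of vc] kurtosis_def[of vc] moran_I_quadratic_form[of A vc] .
  qed
qed

end
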